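(* Let $\xi_i=\xi_i(\epsilon,s)$, $i=1,2,3,4$, be the roots (in $z$) of the polynomial $$\bar\lambda(z;\epsilon,s)=z^4-2\frac{1+t+t^2}{(1+2t)^{3/2}}z^2+4\frac{t(1+t)}{(1+2t)^{9/4}}z+\frac{(1+t)^2(1+4t+t^2)}{(1+2t)^3}-\epsilon,\qquad s=\frac{t(2+t)^3}{(1+2t)^3}.$$ Write $\xi_{ij}=\xi_i-\xi_j$ with indices cyclic mod 4, and $x_i=\frac{\xi_{(i+1)i}}{\xi_{(i+2)i}}$, $y_i=\frac{\xi_{(i+1)i}}{\xi_{(i+3)i}}$. Define $$\chi_{(i)}=\frac1{\sqrt{\xi_{(i+1)i}}\,[\xi_{(i+2)i}\,\xi_{i(i+3)}]^{3/4}}\begin{pmatrix}\xi_{(i+1)i}f(x_i,y_i)+2\xi_i\,g(x_i,y_i)\\ g(x_i,y_i)\end{pmatrix},\qquad i=1,2,$$ where $$f(x,y)=\frac{\sqrt{\sqrt{1-y}+\sqrt{x-y}}-\sqrt{\sqrt{1-y}-\sqrt{x-y}}}{\sqrt{(1-x)(1-y)(x-y)}},$$ $$g(x,y)=\frac1{\sqrt2}\left(1+\frac1{\sqrt{(1-x)(1-y)}}\right)\sqrt{\frac1{\sqrt{1-x}+\sqrt{1-y}}}.$$ Then $(\chi_{(1)},\chi_{(2)})$ is a fundamental solution of the Fuchsian system $$\frac{\partial\chi}{\partial\epsilon}=\left(\frac{B_1}\epsilon+\frac{B_2}{\epsilon-1}+\frac{B_3}{\epsilon-s}\right)\chi,\qquad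 B_i(s)=\mu\begin{pmatrix}\phi_{i2}^2&2\phi_{i2}\phi_{i3}\\ \phi_{i1}\phi_{i2}&2\phi_{i1}\phi_{i3}\end{pmatrix},$$ where $\mu=-\frac14$ and $\Phi=(\phi_{i\alpha}(s))$ is the rescaled transition matrix of the Hurwitz space $\mathcal M_{0,(4)}$ (the $A_3$ singularity), given explicitly in the context.
   Context: The statement is local: $s\ne0,1$, $\epsilon\ne0,1,s$ (so that the $\xi_i$ are distinct), and all roots denote analytic branches. The functions $f,g$ denote the branches with $f(0,0)=g(0,0)=1$ near $(0,0)$ (there they are single-valued analytic functions, equal to the Appell functions $F_1(\frac54;\frac34,\frac34;\frac32;x,y)$ and $F_1(\frac14;\frac34,\frac34;\frac12;x,y)$ respectively) and their simultaneous analytic continuations along a common path. The rescaled transition matrix of $\mathcal M_{0,(4)}$ is $$\Phi(s)=\begin{pmatrix}\frac{(1+2t)^{3/4}}{2\sqrt{(2+t)(1+2t)}}&\frac{-1-t}{\sqrt{(2+t)(1+2t)}}&\frac{1+3t+t^2}{\sqrt{2+t}\,(1+2t)^{5/4}}\\ \frac{(1+2t)^{3/4}}{2\sqrt{(-1+t)(1+2t)}}&\frac t{\sqrt{(-1+t)(1+2t)}}&\frac{-1-t+t^2}{\sqrt{-1+t}\,(1+2t)^{5/4}}\\ \frac{(1+2t)^{3/4}}{2\sqrt{(1-t)(2+t)}}&\frac1{\sqrt{(1-t)(2+t)}}&\frac{1-t-t^2}{\sqrt{(1-t)(2+t)}\,(1+2t)^{3/4}}\end{pmatrix},\qquad s=\frac{t(2+t)^3}{(1+2t)^3},$$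 with the same branch of the square root in the entries of each row and the same branch of $(1+2t)^{1/4}$ throughout (also in $\bar\lambda$). *)

theory Defs
  imports "HOL-Analysis.Analysis"
begin

section \<open>Simultaneous continuation of two functions of two complex variables\<close>

text \<open>Analyticity in two variables is complex Frechet differentiability in a neighbourhood.\<close>

definition analytic2_at :: "(complex \<times> complex \<Rightarrow> complex) \<Rightarrow> complex \<times> complex \<Rightarrow> bool" where
  "analytic2_at F p \<longleftrightarrow>
     (\<forall>\<^sub>F z in nhds p. \<exists>a b. (F has_derivative (\<lambda>h. a * fst h + b * snd h)) (at z))"

text \<open>
  A continuation along \<open>\<gamma>\<close> is a family of germs: only the behaviour of \<open>F \<tau>\<close> near \<open>\<gamma> \<tau>\<close> matters,
  and for \<open>\<sigma>\<close> close to \<open>\<tau>\<close> the germ \<open>F \<sigma>\<close> at \<open>\<gamma> \<sigma>\<close> is the one induced by \<open>F \<tau>\<close>.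
\<close>

definition continuation_along ::
  "(real \<Rightarrow> complex \<times> complex) \<Rightarrow> (real \<Rightarrow> complex \<times> complex \<Rightarrow> complex) \<Rightarrow> bool" where
  "continuation_along \<gamma> F \<longleftrightarrow> path \<gamma> \<and>
     (\<forall>\<tau>\<in>{0..1}. analytic2_at (F \<tau>) (\<gamma> \<tau>) \<and>
        (\<forall>\<^sub>F \<sigma> in at \<tau> within {0..1}. \<forall>\<^sub>F p in nhds (\<gamma> \<sigma>). F \<sigma> p = F \<tau> p))"

text \<open>
  All values of the two algebraic expressions. A root that occurs twice in an expression
  gets the same value at both places.
\<close>

definition f_values :: "complex \<Rightarrow> complex \<Rightarrow> complex set" where
  "f_values x y = {(u - v) / r | b c u v r.
     b\<^sup>2 = 1 - y \<and> c\<^sup>2 = x - y \<and> u\<^sup>2 = b + c \<and> v\<^sup>2 = b - c \<and> r\<^sup>2 = (1 - x) * (1 - y) * (x - y)}"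

definition g_values :: "complex \<Rightarrow> complex \<Rightarrow> complex set" where
  "g_values x y = {1 / of_real (sqrt 2) * (1 + 1 / r) * u | a b r u.
     a\<^sup>2 = 1 - x \<and> b\<^sup>2 = 1 - y \<and> r\<^sup>2 = (1 - x) * (1 - y) \<and> u\<^sup>2 = 1 / (a + b)}"

text \<open>
  The branches at the origin. On \<open>x = y\<close> the expression for \<open>f\<close> has the form \<open>0 / 0\<close>, and the value
  of the branch there is the analytic extension.
\<close>

definition f_germ :: "(complex \<times> complex \<Rightarrow> complex) \<Rightarrow> bool" where
  "f_germ F \<longleftrightarrow> analytic2_at F (0, 0) \<and> F (0, 0) = 1 \<and>
     (\<forall>\<^sub>F p in nhds (0, 0). fst p \<noteq> snd p \<longrightarrow> F p \<in> f_values (fst p) (snd p))"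

definition g_germ :: "(complex \<times> complex \<Rightarrow> complex) \<Rightarrow> bool" where
  "g_germ G \<longleftrightarrow> analytic2_at G (0, 0) \<and> G (0, 0) = 1 \<and>
     (\<forall>\<^sub>F p in nhds (0, 0). G p \<in> g_values (fst p) (snd p))"

definition fg_branch :: "complex \<times> complex \<Rightarrow>
    (complex \<times> complex \<Rightarrow> complex) \<Rightarrow> (complex \<times> complex \<Rightarrow> complex) \<Rightarrow> bool" where
  "fg_branch p F G \<longleftrightarrow> (\<exists>\<gamma> \<F> \<G>. continuation_along \<gamma> \<F> \<and> continuation_along \<gamma> \<G> \<and>
     \<gamma> 0 = (0, 0) \<and> \<gamma> 1 = p \<and> f_germ (\<F> 0) \<and> g_germ (\<G> 0) \<and> \<F> 1 = F \<and> \<G> 1 = G)"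

text \<open>
  \<open>f\<close> and \<open>g\<close> are branches on \<open>U\<close> of the composites \<open>f(x(\<epsilon>), y(\<epsilon>))\<close> and \<open>g(x(\<epsilon>), y(\<epsilon>))\<close>,
  obtained by one common continuation.
\<close>

definition fg_branch_on :: "complex set \<Rightarrow> (complex \<Rightarrow> complex) \<Rightarrow> (complex \<Rightarrow> complex) \<Rightarrow>
    (complex \<Rightarrow> complex) \<Rightarrow> (complex \<Rightarrow> complex) \<Rightarrow> bool" where
  "fg_branch_on U x y f g \<longleftrightarrow> (\<forall>\<epsilon>\<in>U. \<exists>F G. fg_branch (x \<epsilon>, y \<epsilon>) F G \<and>
     (\<forall>\<^sub>F e in nhds \<epsilon>. f e = F (x e, y e) \<and> g e = G (x e, y e)))"


section \<open>The quartic and the transition matrix\<close>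

text \<open>Throughout, \<open>q\<close> is a chosen value of \<open>(1 + 2t)\<^bsup>1/4\<^esup>\<close>.\<close>

definition lambda_bar :: "complex \<Rightarrow> complex \<Rightarrow> complex \<Rightarrow> complex poly" where
  "lambda_bar t q \<epsilon> =
     [: (1 + t)\<^sup>2 * (1 + 4 * t + t\<^sup>2) / (1 + 2 * t) ^ 3 - \<epsilon>,
        4 * (t * (1 + t) / q ^ 9),
        - 2 * ((1 + t + t\<^sup>2) / q ^ 6),
        0, 1 :]"

text \<open>
  \<open>w\<close> holds the square roots of \<open>2 + t\<close>, \<open>-1 + t\<close> and \<open>(1 - t)(2 + t)\<close> for the three rows.
  In the first two rows the square roots of \<open>(2 + t)(1 + 2t)\<close> and \<open>(-1 + t)(1 + 2t)\<close>
  are the products with \<open>q\<^sup>2\<close>.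
\<close>

definition Phi :: "complex \<Rightarrow> complex \<Rightarrow> complex^3 \<Rightarrow> complex^3^3" where
  "Phi t q w = vector
    [vector [q ^ 3 / (2 * (w$1 * q\<^sup>2)), (- 1 - t) / (w$1 * q\<^sup>2), (1 + 3 * t + t\<^sup>2) / (w$1 * q ^ 5)],
     vector [q ^ 3 / (2 * (w$2 * q\<^sup>2)), t / (w$2 * q\<^sup>2), (- 1 - t + t\<^sup>2) / (w$2 * q ^ 5)],
     vector [q ^ 3 / (2 * w$3), 1 / w$3, (1 - t - t\<^sup>2) / (w$3 * q ^ 3)]]"


section \<open>The Fuchsian system\<close>

definition \<mu> :: complex where "\<mu> = - 1 / 4"

definition B :: "complex^3^3 \<Rightarrow> 3 \<Rightarrow> complex^2^2" where
  "B \<Phi> i = vector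
    [vector [\<mu> * (\<Phi>$i$2)\<^sup>2, \<mu> * (2 * \<Phi>$i$2 * \<Phi>$i$3)],
     vector [\<mu> * (\<Phi>$i$1 * \<Phi>$i$2), \<mu> * (2 * \<Phi>$i$1 * \<Phi>$i$3)]]"

definition fuchs_matrix :: "complex^3^3 \<Rightarrow> complex \<Rightarrow> complex \<Rightarrow> complex^2^2" where
  "fuchs_matrix \<Phi> s \<epsilon> =
     (\<chi> j k. B \<Phi> 1 $ j $ k / \<epsilon> + B \<Phi> 2 $ j $ k / (\<epsilon> - 1) + B \<Phi> 3 $ j $ k / (\<epsilon> - s))"

definition fundamental_solution ::
  "complex set \<Rightarrow> (complex \<Rightarrow> complex^'n^'n) \<Rightarrow> (complex \<Rightarrow> complex^'n^'n) \<Rightarrow> bool" where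
  "fundamental_solution U A X \<longleftrightarrow> (\<forall>\<epsilon>\<in>U.
     (\<forall>j k. ((\<lambda>e. X e $ j $ k) has_field_derivative (A \<epsilon> ** X \<epsilon>) $ j $ k) (at \<epsilon>)) \<and>
     invertible (X \<epsilon>))"

text \<open>
  Indices of the roots live in the ring \<open>4\<close> of integers mod 4, so they are cyclic.
\<close>

definition xi_diff :: "(4 \<Rightarrow> complex \<Rightarrow> complex) \<Rightarrow> 4 \<Rightarrow> 4 \<Rightarrow> complex \<Rightarrow> complex" where
  "xi_diff \<xi> i j \<epsilon> = \<xi> i \<epsilon> - \<xi> j \<epsilon>"

definition x_arg :: "(4 \<Rightarrow> complex \<Rightarrow> complex) \<Rightarrow> 4 \<Rightarrow> complex \<Rightarrow> complex" where
  "x_arg \<xi> i \<epsilon> = xi_diff \<xi> (i + 1) i \<epsilon> / xi_diff \<xi> (i + 2) i \<epsilon>"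

definition y_arg :: "(4 \<Rightarrow> complex \<Rightarrow> complex) \<Rightarrow> 4 \<Rightarrow> complex \<Rightarrow> complex" where
  "y_arg \<xi> i \<epsilon> = xi_diff \<xi> (i + 1) i \<epsilon> / xi_diff \<xi> (i + 3) i \<epsilon>"

text \<open>
  \<open>\<sigma>\<close> and \<open>\<rho>\<close> are branches of the square root of \<open>\<xi>\<^bsub>(i+1)i\<^esub>\<close> and
  of the fourth root of \<open>\<xi>\<^bsub>(i+2)i\<^esub> \<xi>\<^bsub>i(i+3)\<^esub>\<close>.
\<close>

definition chi_col :: "(4 \<Rightarrow> complex \<Rightarrow> complex) \<Rightarrow> 4 \<Rightarrow> (complex \<Rightarrow> complex) \<Rightarrow> (complex \<Rightarrow> complex) \<Rightarrow>
    (complex \<Rightarrow> complex) \<Rightarrow> (complex \<Rightarrow> complex) \<Rightarrow> complex \<Rightarrow> complex^2" where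
  "chi_col \<xi> i \<sigma> \<rho> f g \<epsilon> = (1 / (\<sigma> \<epsilon> * \<rho> \<epsilon> ^ 3)) *s
     vector [xi_diff \<xi> (i + 1) i \<epsilon> * f \<epsilon> + 2 * \<xi> i \<epsilon> * g \<epsilon>, g \<epsilon>]"

end

theory Submission
  imports Defs "HOL-Complex_Analysis.Conformal_Mappings"
begin

text \<open>
  With \<open>P\<^sup>2 = (1 - x)(1 - y)\<close> one has \<open>2 g = (1 + P) f\<close> and \<open>f\<^sup>4 P\<^sup>4 (2 - x - y + 2 P) = 4\<close> at the origin.
  Eliminating \<open>P\<close> gives two polynomial relations between \<open>f\<close>, \<open>g\<close>, \<open>x\<close>, \<open>y\<close>, which survive every common
  continuation by the identity theorem and determine all derivatives of \<open>f\<close> and \<open>g\<close>.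

  Write \<open>a, b, c, d\<close> for \<open>\<xi>\<close> at \<open>i, i+1, i+2, i+3\<close>. The column \<open>i\<close> is \<open>N (b + a P, (1 + P) / 2)\<close>, where
  \<open>P\<^sup>2 = (c - b)(d - b) / ((c - a)(d - a))\<close> and \<open>N\<^sup>4\<close> is a rational function of \<open>P\<close> and the roots. The partial
  derivatives of this vector with respect to the roots are linear in it, with coefficients symmetric in the
  other roots. Since \<open>d\<xi>\<^sub>i/d\<epsilon>\<close> is the reciprocal of \<open>\<Prod>\<^sub>j (\<xi>\<^sub>i - \<xi>\<^sub>j)\<close>, the coefficients along the curve are
  sums \<open>\<Sum>\<^sub>i p(\<xi>\<^sub>i) (d\<xi>\<^sub>i/d\<epsilon>)\<^sup>2\<close>, and partial fractions turn these into the sums over the three critical points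
  of the quartic, i.e. into the Fuchsian matrix.

  The columns are independent because \<open>(b + a P) / (1 + P)\<close> is a fixed point of the involution that swaps
  \<open>a, b\<close> and \<open>c, d\<close>, and involutions for different pairings have no common fixed point.
\<close>

section \<open>The algebraic relations between \<open>f\<close> and \<open>g\<close>\<close>

text \<open>The pointwise form of \<open>analytic2_at\<close>, so that closure rules can be proved
  at one point and then used on a whole neighbourhood.\<close>

definition differentiable2 :: "(complex \<times> complex \<Rightarrow> complex) \<Rightarrow> complex \<times> complex \<Rightarrow> bool" where
  "differentiable2 F p \<longleftrightarrow> (\<exists>a b. (F has_derivative (\<lambda>h. a * fst h + b * snd h)) (at p))"

lemma analytic2_at_iff: "analytic2_at F p \<longleftrightarrow> (\<forall>\<^sub>F z in nhds p. differentiable2 F z)"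
  by (simp add: analytic2_at_def differentiable2_def)

lemma differentiable2_const: "differentiable2 (\<lambda>_. c) p"
  unfolding differentiable2_def by (intro exI[of _ 0]) simp

lemma differentiable2_fst: "differentiable2 fst p"
  unfolding differentiable2_def by (intro exI[of _ 1] exI[of _ 0]) (auto intro!: derivative_eq_intros)

lemma differentiable2_snd: "differentiable2 snd p"
  unfolding differentiable2_def by (intro exI[of _ 0] exI[of _ 1]) (auto intro!: derivative_eq_intros)

lemma differentiable2_add:
  assumes "differentiable2 F p" "differentiable2 G p"
  shows "differentiable2 (\<lambda>z. F z + G z) p"
proof -
  from assms obtain a b a' b' where "(F has_derivative (\<lambda>h. a * fst h + b * snd h)) (at p)"
    "(G has_derivative (\<lambda>h. a' * fst h + b' * snd h)) (at p)" unfolding differentiable2_def by blast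
  from has_derivative_add[OF this] show ?thesis
    unfolding differentiable2_def
    by (intro exI[of _ "a + a'"] exI[of _ "b + b'"]) (simp add: algebra_simps)
qed

lemma differentiable2_mult:
  assumes "differentiable2 F p" "differentiable2 G p"
  shows "differentiable2 (\<lambda>z. F z * G z) p"
proof -
  from assms obtain a b a' b' where "(F has_derivative (\<lambda>h. a * fst h + b * snd h)) (at p)"
    "(G has_derivative (\<lambda>h. a' * fst h + b' * snd h)) (at p)" unfolding differentiable2_def by blast
  from has_derivative_mult[OF this] show ?thesis
    unfolding differentiable2_def
    by (intro exI[of _ "F p * a' + a * G p"] exI[of _ "F p * b' + b * G p"]) (simp add: algebra_simps)
qed

lemma differentiable2_diff:
  assumes "differentiable2 F p" "differentiable2 G p"
  shows "differentiable2 (\<lambda>z. F z - G z) p"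
  using differentiable2_add[OF assms(1) differentiable2_mult[OF differentiable2_const[of "- 1"] assms(2)]]
  by simp

lemma differentiable2_power: "differentiable2 F p \<Longrightarrow> differentiable2 (\<lambda>z. F z ^ n) p"
  by (induction n) (simp_all add: differentiable2_const differentiable2_mult)

lemmas differentiable2_intros = differentiable2_const differentiable2_fst differentiable2_snd
  differentiable2_add differentiable2_mult differentiable2_diff differentiable2_power

text \<open>This chain rule serves both for restrictions to complex lines and for the curve traced
  by the two arguments of \<open>f\<close> and \<open>g\<close>.\<close>

lemma differentiable2_compose:
  assumes "differentiable2 F (x z, y z)" "x field_differentiable at z" "y field_differentiable at z"
  shows "(\<lambda>z. F (x z, y z)) field_differentiable at z"
proof -
  obtain a b where F: "(F has_derivative (\<lambda>h. a * fst h + b * snd h)) (at (x z, y z))"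
    using assms(1) unfolding differentiable2_def by blast
  obtain x' y' where "(x has_field_derivative x') (at z)" "(y has_field_derivative y') (at z)"
    using assms(2,3) unfolding field_differentiable_def by blast
  then have "((\<lambda>z. (x z, y z)) has_derivative (\<lambda>h. (x' * h, y' * h))) (at z)"
    unfolding has_field_derivative_def by (rule has_derivative_Pair)
  from has_derivative_compose[OF this F]
  have "((\<lambda>z. F (x z, y z)) has_derivative (\<lambda>h. (a * x' + b * y') * h)) (at z)"
    by (simp add: algebra_simps)
  then show ?thesis unfolding field_differentiable_def has_field_derivative_def by blast
qed

lemma differentiable2_isCont: "differentiable2 F p \<Longrightarrow> isCont F p"
  unfolding differentiable2_def using has_derivative_continuous by blast

section \<open>The identity theorem along complex lines\<close>

text \<open>The parameter is complex, so a function of two variables restricts to a holomorphic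
  function of one variable.\<close>

definition line :: "complex \<times> complex \<Rightarrow> complex \<times> complex \<Rightarrow> complex \<Rightarrow> complex \<times> complex" where
  "line p q t = (fst p + t * (fst q - fst p), snd p + t * (snd q - snd p))"

lemma line_0: "line p q 0 = p" and line_1: "line p q 1 = q"
  by (simp_all add: line_def)

lemma isCont_line: "isCont (line p q) t"
  unfolding line_def by (intro continuous_intros)

text \<open>The parameters whose points lie in \<open>V\<close> form an open convex set that
  contains 0 and 1. The one-variable identity theorem on this set carries the zeros near parameter 0
  to parameter 1.\<close>

lemma line_identity:
  assumes "open V" "convex V" "p \<in> V" "q \<in> V"
    and H: "\<And>z. z \<in> V \<Longrightarrow> differentiable2 H z"
    and 0: "\<forall>\<^sub>F t in at 0. H (line p q t) = 0"
  shows "H q = 0"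
proof -
  define T where "T = line p q -` V"
  have "open T" unfolding T_def
    by (intro open_vimage \<open>open V\<close> continuous_at_imp_continuous_on) (simp add: isCont_line)
  have "convex T"
  proof (rule convexI)
    fix s t and u v :: real
    assume st: "s \<in> T" "t \<in> T" and uv: "0 \<le> u" "0 \<le> v" "u + v = 1"
    have v: "v = 1 - u" using uv by simp
    have "line p q (u *\<^sub>R s + v *\<^sub>R t) = u *\<^sub>R line p q s + v *\<^sub>R line p q t"
      unfolding v by (simp add: line_def prod_eq_iff scaleR_conv_of_real algebra_simps)
    then show "u *\<^sub>R s + v *\<^sub>R t \<in> T"
      using convexD[OF \<open>convex V\<close>, of "line p q s" "line p q t" u v] st uv by (simp add: T_def)
  qed
  have T01: "0 \<in> T" "1 \<in> T" using assms(3,4) by (simp_all add: T_def line_0 line_1)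
  have hol: "(\<lambda>t. H (line p q t)) holomorphic_on T"
  proof (rule holomorphic_onI)
    fix t assume "t \<in> T"
    then have "differentiable2 H (line p q t)" using H by (simp add: T_def)
    then have "(\<lambda>t. H (line p q t)) field_differentiable at t"
      unfolding line_def by (rule differentiable2_compose) (auto intro!: derivative_intros)
    then show "(\<lambda>t. H (line p q t)) field_differentiable at t within T"
      by (rule field_differentiable_at_within)
  qed
  obtain r where r: "r > 0" "ball 0 r \<subseteq> T" "\<And>t. t \<in> ball 0 r \<Longrightarrow> t \<noteq> 0 \<Longrightarrow> H (line p q t) = 0"
  proof -
    obtain r1 where "r1 > 0" "ball 0 r1 \<subseteq> T" using \<open>open T\<close> T01 open_contains_ball by blast
    moreover obtain r2 where "r2 > 0" "\<And>t. t \<noteq> 0 \<Longrightarrow> dist t 0 < r2 \<Longrightarrow> H (line p q t) = 0"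
      using 0 unfolding eventually_at by auto
    ultimately show thesis by (intro that[of "min r1 r2"]) auto
  qed
  show ?thesis
  proof -
    have "H (line p q 1) = 0"
    proof (rule analytic_continuation[OF hol \<open>open T\<close> convex_connected[OF \<open>convex T\<close>] _ \<open>0 \<in> T\<close> _ _ \<open>1 \<in> T\<close>])
      show "ball 0 r - {0} \<subseteq> T" using r by auto
      have "(0::complex) islimpt ball 0 r" using r(1) islimpt_ball[of 0 0 r] by simp
      then show "(0::complex) islimpt (ball 0 r - {0})"
        using islimpt_punctured by blast
      show "H (line p q t) = 0" if "t \<in> ball 0 r - {0}" for t using r(3) that by auto
    qed
    then show ?thesis by (simp add: line_1)
  qed
qed

section \<open>Polynomial relations for the germs at the origin\<close>

text \<open>With 2 G - F = P F this is the equation P^2 = (1 - x)(1 - y), multiplied by F^2.\<close>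

definition fg_rel1 :: "(complex \<times> complex \<Rightarrow> complex) \<Rightarrow> (complex \<times> complex \<Rightarrow> complex) \<Rightarrow> complex \<times> complex \<Rightarrow> complex" where
  "fg_rel1 F G p = (2 * G p - F p)\<^sup>2 - (1 - fst p) * (1 - snd p) * (F p)\<^sup>2"

text \<open>This is F^4 P^4 (2 - x - y + 2 P) = 4 without P: P^4 is the square of (1 - x)(1 - y),
  and F (2 - x - y + 2 P) equals 4 G - (x + y) F.\<close>

definition fg_rel2 :: "(complex \<times> complex \<Rightarrow> complex) \<Rightarrow> (complex \<times> complex \<Rightarrow> complex) \<Rightarrow> complex \<times> complex \<Rightarrow> complex" where
  "fg_rel2 F G p = ((1 - fst p) * (1 - snd p))\<^sup>2 * F p ^ 3 * (4 * G p - (fst p + snd p) * F p) - 4"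

lemma differentiable2_fg_rel:
  assumes "differentiable2 F p" "differentiable2 G p"
  shows "differentiable2 (fg_rel1 F G) p" "differentiable2 (fg_rel2 F G) p"
  unfolding fg_rel1_def[abs_def] fg_rel2_def[abs_def] by (intro differentiable2_intros assms)+

text \<open>The product \<open>a = u * v\<close> is a square root of 1 - x, since (b + c)(b - c) = 1
  - x. Squaring \<open>z * r = u - v\<close> and using b^2 - a^2 = x - y gives z^2 D (a + b) = 2,
  and \<open>P\<close> is the product a b recovered from (a + b)^2. Being a formula in
  \<open>z\<close>, it follows the branch of \<open>f\<close> continuously.\<close>

lemma f_values_relation:
  assumes "z \<in> f_values x y" "x \<noteq> y" "x \<noteq> 1" "y \<noteq> 1"
  defines "D \<equiv> (1 - x) * (1 - y)"
  defines "P \<equiv> ((2 / (z\<^sup>2 * D))\<^sup>2 - (2 - x - y)) / 2"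
  shows "P\<^sup>2 = D" "z ^ 4 * P ^ 4 * (2 - x - y + 2 * P) = 4"
proof -
  obtain b c u v r where z: "z = (u - v) / r" and e: "b\<^sup>2 = 1 - y" "c\<^sup>2 = x - y" "u\<^sup>2 = b + c"
    "v\<^sup>2 = b - c" "r\<^sup>2 = (1 - x) * (1 - y) * (x - y)"
    using assms(1) unfolding f_values_def by blast
  define a where "a = u * v"
  have a: "a\<^sup>2 = 1 - x" unfolding a_def using e by algebra
  have "D \<noteq> 0" "r \<noteq> 0" using assms e(5) by (auto simp: D_def)
  have "z * r = u - v" using z \<open>r \<noteq> 0\<close> by simp
  then have "z\<^sup>2 * r\<^sup>2 = 2 * (b - a)" unfolding a_def using e by algebra
  then have "z\<^sup>2 * D * (a + b) * (x - y) = 2 * (x - y)"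
    unfolding D_def using e a by algebra
  then have "(z\<^sup>2 * D * (a + b) - 2) * (x - y) = 0" by algebra
  then have s: "z\<^sup>2 * D * (a + b) = 2" using \<open>x \<noteq> y\<close> by simp
  then have nz: "z\<^sup>2 * D \<noteq> 0" by auto
  have "a + b = 2 / (z\<^sup>2 * D)" using s nz by (simp add: nonzero_eq_divide_eq mult.commute)
  then have "P = ((a + b)\<^sup>2 - (2 - x - y)) / 2" unfolding P_def by simp
  also have "\<dots> = a * b" using a e(1) by (simp add: field_simps power2_eq_square) algebra
  finally have P: "P = a * b" .
  then show P2: "P\<^sup>2 = D" using a e(1) by (simp add: D_def power_mult_distrib)
  have "2 - x - y + 2 * P = (a + b)\<^sup>2" unfolding P using a e(1) by algebra
  then have "z ^ 4 * P ^ 4 * (2 - x - y + 2 * P) = (z\<^sup>2 * D * (a + b))\<^sup>2"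
    using P2 by algebra
  then show "z ^ 4 * P ^ 4 * (2 - x - y + 2 * P) = 4" unfolding s by simp
qed

text \<open>After raising to the fourth power only two ambiguities are left: the sign
  \<open>\<sigma>\<close> of \<open>r\<close> relative to \<open>P\<close>, and the sign
  \<open>\<tau>\<close> of a b relative to \<open>P\<close>.\<close>

lemma g_values_relation:
  assumes "z \<in> g_values x y" "z \<noteq> 0" "x \<noteq> 1" "y \<noteq> 1" and P: "P\<^sup>2 = (1 - x) * (1 - y)"
  shows "\<exists>\<sigma>\<in>{1, - 1}. \<exists>\<tau>\<in>{1, - 1}. 4 * z ^ 4 * (2 - x - y + 2 * \<tau> * P) = (1 + \<sigma> / P) ^ 4"
proof -
  obtain a b r u where z: "z = 1 / of_real (sqrt 2) * (1 + 1 / r) * u" and e: "a\<^sup>2 = 1 - x" "b\<^sup>2 = 1 - y"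
    "r\<^sup>2 = (1 - x) * (1 - y)" "u\<^sup>2 = 1 / (a + b)"
    using assms(1) unfolding g_values_def by blast
  have "u \<noteq> 0" using z assms(2) by auto
  then have "a + b \<noteq> 0" using e(4) by auto
  have "P \<noteq> 0" using P assms by auto
  have "r\<^sup>2 = P\<^sup>2" "(a * b)\<^sup>2 = P\<^sup>2" using P e by (auto simp: power_mult_distrib)
  then obtain \<sigma> \<tau> where s: "\<sigma> \<in> {1, - 1}" "r = \<sigma> * P" and t: "\<tau> \<in> {1, - 1}" "a * b = \<tau> * P"
    unfolding power2_eq_iff by (metis insert_iff mult_1 mult_minus1)
  have sqrt2: "(complex_of_real (sqrt 2))\<^sup>2 = 2" by (simp flip: of_real_power)
  have "2 * z\<^sup>2 = (1 + 1 / r)\<^sup>2 * u\<^sup>2" unfolding z by (simp add: power_mult_distrib power_divide sqrt2)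
  moreover have "u\<^sup>2 * (a + b) = 1" using e(4) \<open>a + b \<noteq> 0\<close> by simp
  ultimately have "2 * z\<^sup>2 * (a + b) = (1 + 1 / r)\<^sup>2" by (simp add: mult.assoc)
  then have "(2 * z\<^sup>2 * (a + b))\<^sup>2 = ((1 + 1 / r)\<^sup>2)\<^sup>2" by simp
  then have "4 * z ^ 4 * (a + b)\<^sup>2 = (1 + 1 / r) ^ 4" by (simp add: power_mult_distrib)
  moreover have "(a + b)\<^sup>2 = 2 - x - y + 2 * \<tau> * P" using e t(2) by algebra
  moreover have "1 / r = \<sigma> / P" using s by auto
  ultimately have "4 * z ^ 4 * (2 - x - y + 2 * \<tau> * P) = (1 + \<sigma> / P) ^ 4" by simp
  then show ?thesis using s(1) t(1) by blast
qed

text \<open>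
  On a complex line through the origin the wrong branches of the roots in \<open>g\<close> are excluded near the
  origin. In two variables they are not: near \<open>(x + y)\<^sup>2 = 4 (y - x)\<close> they give values close to \<open>1\<close>.
\<close>

lemma fg_germ_on_line:
  assumes "f_germ F" "g_germ G" "x \<noteq> y"
  shows "\<forall>\<^sub>F t in at 0. fg_rel1 F G (t * x, t * y) = 0 \<and> fg_rel2 F G (t * x, t * y) = 0"
proof -
  have lim: "((\<lambda>t. (t * x, t * y)) \<longlongrightarrow> (0, 0)) (at 0)"
    by (rule tendsto_eq_intros refl | simp)+
  have cont: "isCont F (0, 0)" "isCont G (0, 0)"
    using assms(1,2) unfolding f_germ_def g_germ_def analytic2_at_iff
    by (auto dest!: eventually_nhds_x_imp_x intro: differentiable2_isCont)
  have F: "((\<lambda>t. F (t * x, t * y)) \<longlongrightarrow> 1) (at 0)"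
    using isCont_tendsto_compose[OF cont(1) lim] assms(1) by (simp add: f_germ_def)
  have G: "((\<lambda>t. G (t * x, t * y)) \<longlongrightarrow> 1) (at 0)"
    using isCont_tendsto_compose[OF cont(2) lim] assms(2) by (simp add: g_germ_def)
  define D where "D = (\<lambda>t. (1 - t * x) * (1 - t * y))"
  \<comment> \<open>This is the formula of \<open>f_values_relation\<close> evaluated along the
    line; it tends to (4 - 2) / 2 = 1.\<close>
  define P where "P = (\<lambda>t. ((2 / ((F (t * x, t * y))\<^sup>2 * D t))\<^sup>2 - (2 - t * x - t * y)) / 2)"
  have D: "(D \<longlongrightarrow> 1) (at 0)" unfolding D_def by (rule tendsto_eq_intros refl | simp)+
  have P: "(P \<longlongrightarrow> 1) (at 0)" unfolding P_def by (rule tendsto_eq_intros F D refl | simp)+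
  \<comment> \<open>Zeros of \<open>h1\<close>, \<open>h2\<close> and \<open>h3\<close> correspond
    to the wrong sign pairs (\<open>\<tau>\<close>, \<open>\<sigma>\<close>) = (1, -1), (-1, 1) and
    (-1, -1). In the last case both sides of the relation tend to 0, so \<open>h3\<close> is that
    relation multiplied by conjugate factors and divided by t^2. Finally \<open>h4\<close> is the
    cofactor of 2 G - W in (2 G)^4 - W^4. All four have nonzero limits.\<close>
  define h1 where "h1 = (\<lambda>t. 4 * G (t * x, t * y) ^ 4 * (2 - t * x - t * y + 2 * P t) - (1 + - 1 / P t) ^ 4)"
  define h2 where "h2 = (\<lambda>t. 4 * G (t * x, t * y) ^ 4 * (2 - t * x - t * y - 2 * P t) - (1 + 1 / P t) ^ 4)"
  define h3 where "h3 = (\<lambda>t. 4 * G (t * x, t * y) ^ 4 * P t ^ 4 * (P t + 1) ^ 4 * (x - y)\<^sup>2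
      - t\<^sup>2 * (t * x * y - x - y) ^ 4 * (2 - t * x - t * y + 2 * P t))"
  define W where "W = (\<lambda>t. (1 + P t) * F (t * x, t * y))"
  define h4 where "h4 = (\<lambda>t. (2 * G (t * x, t * y)) ^ 3 + (2 * G (t * x, t * y))\<^sup>2 * W t
      + 2 * G (t * x, t * y) * (W t)\<^sup>2 + W t ^ 3)"
  have "(h1 \<longlongrightarrow> 16) (at 0)" unfolding h1_def by (rule tendsto_eq_intros G P refl | simp)+
  then have 1: "\<forall>\<^sub>F t in at 0. h1 t \<noteq> 0" by (rule tendsto_imp_eventually_ne) simp
  have "(h2 \<longlongrightarrow> - 16) (at 0)" unfolding h2_def by (rule tendsto_eq_intros G P refl | simp)+
  then have 2: "\<forall>\<^sub>F t in at 0. h2 t \<noteq> 0" by (rule tendsto_imp_eventually_ne) simp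
  have "(h3 \<longlongrightarrow> 64 * (x - y)\<^sup>2) (at 0)" unfolding h3_def by (rule tendsto_eq_intros G P refl | simp)+
  then have 3: "\<forall>\<^sub>F t in at 0. h3 t \<noteq> 0" by (rule tendsto_imp_eventually_ne) (use assms in simp)
  have W: "(W \<longlongrightarrow> 2) (at 0)" unfolding W_def by (rule tendsto_eq_intros F P refl | simp)+
  have "(h4 \<longlongrightarrow> 32) (at 0)" unfolding h4_def by (rule tendsto_eq_intros G W refl | simp)+
  then have 4: "\<forall>\<^sub>F t in at 0. h4 t \<noteq> 0" by (rule tendsto_imp_eventually_ne) simp
  have 5: "\<forall>\<^sub>F t in at 0. G (t * x, t * y) \<noteq> 0" "\<forall>\<^sub>F t in at 0. D t \<noteq> 0" "\<forall>\<^sub>F t in at 0. P t \<noteq> 0"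
    by (rule tendsto_imp_eventually_ne[OF G] tendsto_imp_eventually_ne[OF D] tendsto_imp_eventually_ne[OF P], simp)+
  have "\<forall>\<^sub>F p in nhds (0, 0). (fst p \<noteq> snd p \<longrightarrow> F p \<in> f_values (fst p) (snd p)) \<and> G p \<in> g_values (fst p) (snd p)"
    using assms(1,2) unfolding f_germ_def g_germ_def by (auto intro: eventually_conj)
  from eventually_compose_filterlim[OF this lim]
  have 6: "\<forall>\<^sub>F t in at 0. (t * x \<noteq> t * y \<longrightarrow> F (t * x, t * y) \<in> f_values (t * x) (t * y)) \<and>
      G (t * x, t * y) \<in> g_values (t * x) (t * y)" by simp
  have 7: "\<forall>\<^sub>F t in at 0. t \<noteq> (0::complex)" by (simp add: eventually_at_filter)
  show ?thesis using 1 2 3 4 5 6 7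
  proof eventually_elim
    case (elim t)
    define f where "f = F (t * x, t * y)"
    define g where "g = G (t * x, t * y)"
    have D: "D t = (1 - t * x) * (1 - t * y)" by (simp add: D_def)
    have ne: "t * x \<noteq> t * y" "t * x \<noteq> 1" "t * y \<noteq> 1" using elim \<open>x \<noteq> y\<close> by (auto simp: D)
    have rel: "(P t)\<^sup>2 = D t" "f ^ 4 * P t ^ 4 * (2 - t * x - t * y + 2 * P t) = 4"
      using f_values_relation[of f "t * x" "t * y"] ne elim unfolding P_def D_def f_def by auto
    obtain \<sigma> \<tau> where st: "\<sigma> \<in> {1, - 1}" "\<tau> \<in> {1, - 1}"
      and gst: "4 * g ^ 4 * (2 - t * x - t * y + 2 * \<tau> * P t) = (1 + \<sigma> / P t) ^ 4"
      using g_values_relation[of g "t * x" "t * y" "P t"] elim ne rel(1) unfolding g_def D by blast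
    have "\<tau> = 1 \<and> \<sigma> = 1"
    proof (rule ccontr)
      assume "\<not> (\<tau> = 1 \<and> \<sigma> = 1)"
      then consider "\<tau> = 1" "\<sigma> = - 1" | "\<tau> = - 1" "\<sigma> = 1" | "\<tau> = - 1" "\<sigma> = - 1" using st by auto
      then show False
      proof cases
        case 1
        then show False using gst elim(1) by (simp add: h1_def g_def)
      next
        case 2
        then show False using gst elim(2) by (simp add: h2_def g_def)
      next
        case 3
        have "4 * g ^ 4 * (2 - t * x - t * y - 2 * P t) * P t ^ 4 = ((1 - 1 / P t) * P t) ^ 4"
          using gst 3 by (simp add: power_mult_distrib)
        also have "(1 - 1 / P t) * P t = P t - 1" using elim by (simp add: field_simps)
        finally have q: "4 * g ^ 4 * (2 - t * x - t * y - 2 * P t) * P t ^ 4 = (P t - 1) ^ 4" .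
        \<comment> \<open>The products with the conjugates show that the two sides vanish to
          different orders in t: the left one contributes t^2, the right one t^4.\<close>
        have "(2 - t * x - t * y - 2 * P t) * (2 - t * x - t * y + 2 * P t) = t\<^sup>2 * (x - y)\<^sup>2"
          "(P t - 1) * (P t + 1) = t * (t * x * y - x - y)"
          using rel(1) unfolding D by algebra+
        then have "t\<^sup>2 * h3 t = 0" using q unfolding h3_def g_def[symmetric] by algebra
        then show False using elim by simp
      qed
    qed
    then have "4 * g ^ 4 * (2 - t * x - t * y + 2 * P t) * P t ^ 4 = ((1 + 1 / P t) * P t) ^ 4"
      using gst by (simp add: power_mult_distrib)
    also have "(1 + 1 / P t) * P t = 1 + P t" using elim by (simp add: field_simps)
    finally have "(2 * g) ^ 4 = W t ^ 4" using rel(2) unfolding W_def f_def[symmetric] by algebra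
    \<comment> \<open>Since both 2 g and \<open>W\<close> are close to 2, the equality of fourth
      powers leaves only 2 g = W.\<close>
    then have "(2 * g - W t) * h4 t = 0" unfolding h4_def g_def[symmetric] by algebra
    then have "2 * g = (1 + P t) * f" using elim by (simp add: W_def f_def)
    then show ?case using rel unfolding fg_rel1_def fg_rel2_def fst_conv snd_conv f_def[symmetric] g_def[symmetric] D
      by (intro conjI; algebra)
  qed
qed

text \<open>A point off the diagonal is reached from the origin along a complex line on which
  \<open>fg_germ_on_line\<close> applies. A diagonal point is then reached from an off-diagonal one,
  along a line that is off the diagonal near its start.\<close>

lemma fg_germ_relations:
  assumes "f_germ F" "g_germ G"
  shows "\<forall>\<^sub>F p in nhds (0, 0). fg_rel1 F G p = 0 \<and> fg_rel2 F G p = 0"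
proof -
  have "\<forall>\<^sub>F p in nhds (0, 0). differentiable2 F p \<and> differentiable2 G p"
    using assms unfolding f_germ_def g_germ_def analytic2_at_iff by (auto intro: eventually_conj)
  then obtain r where r: "r > 0" and d: "\<And>p. p \<in> ball (0, 0) r \<Longrightarrow> differentiable2 F p \<and> differentiable2 G p"
    unfolding eventually_nhds_metric by (auto simp: dist_commute)
  let ?V = "ball (0 :: complex \<times> complex) r"
  have V: "open ?V" "convex ?V" by auto
  have dV: "differentiable2 (fg_rel1 F G) p" "differentiable2 (fg_rel2 F G) p" if "p \<in> ?V" for p
    using differentiable2_fg_rel d[of p] that by (auto simp: zero_prod_def)
  have off_diag: "fg_rel1 F G p = 0 \<and> fg_rel2 F G p = 0" if p: "p \<in> ?V" "fst p \<noteq> snd p" for p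
  proof -
    have "\<forall>\<^sub>F t in at 0. fg_rel1 F G (line 0 p t) = 0 \<and> fg_rel2 F G (line 0 p t) = 0"
      using fg_germ_on_line[OF assms p(2)] by (simp add: line_def)
    then show ?thesis
      using line_identity[OF V _ p(1), of 0 "fg_rel1 F G"] line_identity[OF V _ p(1), of 0 "fg_rel2 F G"] dV r
      by (simp add: eventually_conj_iff)
  qed
  have "fg_rel1 F G p = 0 \<and> fg_rel2 F G p = 0" if p: "p \<in> ?V" for p
  proof (cases "fst p = snd p")
    case False
    then show ?thesis using off_diag p by blast
  next
    case True
    define q :: "complex \<times> complex" where "q = (of_real (r / 2), 0)"
    have q: "q \<in> ?V" "fst q - snd q \<noteq> 0" using r by (auto simp: q_def norm_Pair)
    have "\<forall>\<^sub>F t in at 0. line q p t \<in> ?V"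
      using isCont_line[of 0 q p] unfolding isCont_def line_0 by (rule topological_tendstoD[OF _ V(1) q(1)])
    moreover have "((\<lambda>t. fst (line q p t) - snd (line q p t)) \<longlongrightarrow> fst q - snd q) (at 0)"
      using isCont_line[of 0 q p] unfolding isCont_def line_0 by (intro tendsto_intros)
    then have "\<forall>\<^sub>F t in at 0. fst (line q p t) - snd (line q p t) \<noteq> 0"
      using q(2) by (rule tendsto_imp_eventually_ne)
    ultimately have "\<forall>\<^sub>F t in at 0. fg_rel1 F G (line q p t) = 0 \<and> fg_rel2 F G (line q p t) = 0"
      by eventually_elim (use off_diag in auto)
    then show ?thesis
      using line_identity[OF V q(1) p, of "fg_rel1 F G"] line_identity[OF V q(1) p, of "fg_rel2 F G"] dV
      by (simp add: eventually_conj_iff)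
  qed
  then show ?thesis using r unfolding eventually_nhds_metric
    by (intro exI[of _ r]) (auto simp: zero_prod_def dist_commute)
qed

section \<open>Persistence of the relations under continuation\<close>

lemma identity_ball:
  assumes "p \<in> ball c r" "q \<in> ball c r" and d: "\<And>z. z \<in> ball c r \<Longrightarrow> differentiable2 H z"
    and 0: "\<forall>\<^sub>F z in nhds p. H z = 0"
  shows "H q = 0"
proof (rule line_identity[OF open_ball convex_ball assms(1,2) d])
  have "(line p q \<longlongrightarrow> p) (at 0)" using isCont_line[of 0 p q] by (simp add: isCont_def line_0)
  then show "\<forall>\<^sub>F t in at 0. H (line p q t) = 0" using 0 by (rule eventually_compose_filterlim[rotated])
qed

text \<open>Validity of the relations near \<open>\<gamma> \<tau>\<close> is locally constant in
  \<open>\<tau>\<close>: nearby germs come from functions differentiable on one common ball, where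
  the identity theorem applies in both directions. It holds at parameter 0, and the interval is
  connected.\<close>

lemma fg_branch_relations:
  assumes "fg_branch p F G"
  shows "\<forall>\<^sub>F z in nhds p. fg_rel1 F G z = 0 \<and> fg_rel2 F G z = 0"
proof -
  obtain \<gamma> \<F> \<G> where c: "continuation_along \<gamma> \<F>" "continuation_along \<gamma> \<G>"
    and ends: "\<gamma> 0 = (0, 0)" "\<gamma> 1 = p" "f_germ (\<F> 0)" "g_germ (\<G> 0)" "\<F> 1 = F" "\<G> 1 = G"
    using assms unfolding fg_branch_def by blast
  define Q where "Q \<tau> \<longleftrightarrow> (\<forall>\<^sub>F z in nhds (\<gamma> \<tau>). fg_rel1 (\<F> \<tau>) (\<G> \<tau>) z = 0 \<and> fg_rel2 (\<F> \<tau>) (\<G> \<tau>) z = 0)" for \<tau>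
  have local: "\<forall>\<^sub>F \<sigma> in at \<tau> within {0..1}. Q \<sigma> = Q \<tau>" if t: "\<tau> \<in> {0..1}" for \<tau>
  proof -
    have "\<forall>\<^sub>F z in nhds (\<gamma> \<tau>). differentiable2 (\<F> \<tau>) z \<and> differentiable2 (\<G> \<tau>) z"
      using c t unfolding continuation_along_def analytic2_at_iff by (auto intro: eventually_conj)
    then obtain r where r: "r > 0" and d: "\<And>z. z \<in> ball (\<gamma> \<tau>) r \<Longrightarrow> differentiable2 (\<F> \<tau>) z \<and> differentiable2 (\<G> \<tau>) z"
      unfolding eventually_nhds_metric by (auto simp: dist_commute)
    let ?R1 = "fg_rel1 (\<F> \<tau>) (\<G> \<tau>)" and ?R2 = "fg_rel2 (\<F> \<tau>) (\<G> \<tau>)"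
    have dR: "differentiable2 ?R1 z" "differentiable2 ?R2 z" if "z \<in> ball (\<gamma> \<tau>) r" for z
      using differentiable2_fg_rel d[OF that] by auto
    \<comment> \<open>Inside the ball, vanishing near one point is equivalent to vanishing near any
      other.\<close>
    have everywhere: "\<forall>\<^sub>F z in nhds q'. ?R1 z = 0 \<and> ?R2 z = 0"
      if q: "q \<in> ball (\<gamma> \<tau>) r" "q' \<in> ball (\<gamma> \<tau>) r" and 0: "\<forall>\<^sub>F z in nhds q. ?R1 z = 0 \<and> ?R2 z = 0" for q q'
    proof -
      have "?R1 z = 0 \<and> ?R2 z = 0" if z: "z \<in> ball (\<gamma> \<tau>) r" for z
        using identity_ball[OF q(1) z dR(1)] identity_ball[OF q(1) z dR(2)] 0 by (simp add: eventually_conj_iff)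
      moreover have "\<forall>\<^sub>F z in nhds q'. z \<in> ball (\<gamma> \<tau>) r" using q(2) by (intro eventually_nhds_in_open) auto
      ultimately show ?thesis by (rule eventually_mono[rotated])
    qed
    have "path \<gamma>" using c by (simp add: continuation_along_def)
    then have "(\<gamma> \<longlongrightarrow> \<gamma> \<tau>) (at \<tau> within {0..1})" using t by (simp add: path_def continuous_on_def)
    then have "\<forall>\<^sub>F \<sigma> in at \<tau> within {0..1}. \<gamma> \<sigma> \<in> ball (\<gamma> \<tau>) r"
      using r by (intro topological_tendstoD) auto
    moreover have "\<forall>\<^sub>F \<sigma> in at \<tau> within {0..1}. \<forall>\<^sub>F z in nhds (\<gamma> \<sigma>). \<F> \<sigma> z = \<F> \<tau> z"
      "\<forall>\<^sub>F \<sigma> in at \<tau> within {0..1}. \<forall>\<^sub>F z in nhds (\<gamma> \<sigma>). \<G> \<sigma> z = \<G> \<tau> z"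
      using c t by (auto simp: continuation_along_def)
    ultimately show ?thesis
    proof eventually_elim
      case (elim \<sigma>)
      have "Q \<sigma> \<longleftrightarrow> (\<forall>\<^sub>F z in nhds (\<gamma> \<sigma>). ?R1 z = 0 \<and> ?R2 z = 0)"
        unfolding Q_def
        by (rule eventually_cong[OF eventually_conj[OF elim(2,3)]]) (simp add: fg_rel1_def fg_rel2_def)
      also have "\<dots> \<longleftrightarrow> Q \<tau>"
        using everywhere[OF elim(1), of "\<gamma> \<tau>"] everywhere[of "\<gamma> \<tau>" "\<gamma> \<sigma>"] elim(1) r unfolding Q_def by auto
      finally show ?case .
    qed
  qed
  have "Q 0 = Q 1"
  \<comment> \<open>Equality of the truth values of \<open>Q\<close> is an equivalence relation with
    open classes, hence has a single class on the interval.\<close>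
  proof (rule connected_equivalence_relation[of "{0..1}" 0 1 "\<lambda>a b. Q a = Q b"])
    fix \<tau> :: real assume t: "\<tau> \<in> {0..1}"
    obtain S where S: "open S" "\<tau> \<in> S" "\<And>\<sigma>. \<sigma> \<in> S \<Longrightarrow> \<sigma> \<noteq> \<tau> \<Longrightarrow> \<sigma> \<in> {0..1} \<Longrightarrow> Q \<sigma> = Q \<tau>"
      using local[OF t] unfolding eventually_at_topological by blast
    show "\<exists>T. openin (top_of_set {0..1}) T \<and> \<tau> \<in> T \<and> (\<forall>\<sigma>\<in>T. Q \<tau> = Q \<sigma>)"
    proof (intro exI conjI ballI)
      show "openin (top_of_set {0..1}) ({0..1} \<inter> S)" using S(1) by (rule openin_open_Int)
      show "\<tau> \<in> {0..1} \<inter> S" using S(2) t by simp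
      show "Q \<tau> = Q \<sigma>" if "\<sigma> \<in> {0..1} \<inter> S" for \<sigma>
        using S(3)[of \<sigma>] that by (cases "\<sigma> = \<tau>") simp_all
    qed
  qed simp_all
  moreover have "Q 0" using fg_germ_relations[OF ends(3,4)] by (simp add: Q_def ends)
  ultimately show ?thesis by (simp add: Q_def ends)
qed

section \<open>Derivatives with respect to the roots\<close>

text \<open>
  Here \<open>a = 0\<close> and \<open>b = u\<close>. The values \<open>pa\<close>, \<open>pb\<close>, \<open>pc\<close>, \<open>pd\<close> are the partial derivatives of \<open>P\<close> with respect
  to the four roots, and \<open>na\<close>, \<open>nb\<close>, \<open>nc\<close>, \<open>nd\<close> are those of \<open>ln N\<close>. The auxiliary quantity \<open>k\<close>, a square root
  of a cross ratio, makes all of them rational.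
\<close>

lemma period_partials:
  fixes u c d P k v :: complex
  assumes nz: "u \<noteq> 0" "c \<noteq> 0" "d \<noteq> 0" "c \<noteq> u" "d \<noteq> u" "c \<noteq> d" "1 + k \<noteq> 0"
    and r: "P * c = k * (c - u)" "k * P * d = d - u"
    and v: "2 * v = 1 + P"
  defines "pa \<equiv> P / 2 * (1 / c + 1 / d)"
    and "na \<equiv> - (- 2 / u + (- 1 / d - k / c) / (1 + k)) / 4"
    and "pb \<equiv> - P / 2 * (1 / (c - u) + 1 / (d - u))"
    and "nb \<equiv> - (2 * (- 1 / (c - u) - 1 / (d - u)) + 2 / u + (- 1 / (c - u) - k / (d - u)) / (1 + k)) / 4"
    and "pc \<equiv> P / 2 * (1 / (c - u) - 1 / c)"
    and "nc \<equiv> - (2 / (c - u) + (1 / (c - u) + k / c) / (1 + k)) / 4"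
    and "pd \<equiv> P / 2 * (1 / (d - u) - 1 / d)"
    and "nd \<equiv> - (2 / (d - u) + (1 / d + k / (d - u)) / (1 + k)) / 4"
  shows "pa / 2 + na * v = - (u + c + d) / (8 * u * c * d) * u + (1 / u + 1 / c + 1 / d) / 2 * v"
    "P + na * u = 3 / 2 * v"
    "pb / 2 + nb * v = - ((- u) + (c - u) + (d - u)) / (8 * (- u) * (c - u) * (d - u)) * (- (u * P))
        + (1 / (- u) + 1 / (c - u) + 1 / (d - u)) / 2 * v"
    "1 - u * pb + nb * - (u * P) = 3 / 2 * v"
    "pc / 2 + nc * v = - ((- c) + (u - c) + (d - c)) / (8 * (- c) * (u - c) * (d - c)) * (u - c - c * P)
        + (1 / (- c) + 1 / (u - c) + 1 / (d - c)) / 2 * v"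
    "- c * pc + nc * (u - c - c * P) = 3 / 2 * v"
    "pd / 2 + nd * v = - ((- d) + (u - d) + (c - d)) / (8 * (- d) * (u - d) * (c - d)) * (u - d - d * P)
        + (1 / (- d) + 1 / (u - d) + 1 / (c - d)) / 2 * v"
    "- d * pd + nd * (u - d - d * P) = 3 / 2 * v"
proof -
  have ne: "u - c \<noteq> 0" "d - c \<noteq> 0" "u - d \<noteq> 0" "c - d \<noteq> 0" "c - u \<noteq> 0" "d - u \<noteq> 0"
    using nz by auto
  \<comment> \<open>For each root e the right-hand sides have one shape, symmetric in the other
    three roots: the factor multiplying the first coefficient is the first component over N minus 2
    e \<open>v\<close>. Clearing denominators leaves polynomial consequences of \<open>r\<close> and
    \<open>v\<close>.\<close>
  show "pa / 2 + na * v = - (u + c + d) / (8 * u * c * d) * u + (1 / u + 1 / c + 1 / d) / 2 * v"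
    unfolding na_def pa_def using nz ne
    by (simp add: divide_simps) (use r v in algebra)
  show "P + na * u = 3 / 2 * v"
    unfolding na_def using nz ne
    by (simp add: divide_simps) (use r v in algebra)
  show "pb / 2 + nb * v = - ((- u) + (c - u) + (d - u)) / (8 * (- u) * (c - u) * (d - u)) * (- (u * P))
        + (1 / (- u) + 1 / (c - u) + 1 / (d - u)) / 2 * v"
    unfolding nb_def pb_def using nz ne
    by (simp add: divide_simps) (use r v in algebra)
  show "1 - u * pb + nb * - (u * P) = 3 / 2 * v"
    unfolding nb_def pb_def using nz ne
    by (simp add: divide_simps) (use r v in algebra)
  show "pc / 2 + nc * v = - ((- c) + (u - c) + (d - c)) / (8 * (- c) * (u - c) * (d - c)) * (u - c - c * P)
        + (1 / (- c) + 1 / (u - c) + 1 / (d - c)) / 2 * v"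
    unfolding nc_def pc_def using nz ne
    by (simp add: divide_simps) (use r v in algebra)
  show "- c * pc + nc * (u - c - c * P) = 3 / 2 * v"
    unfolding nc_def pc_def using nz ne
    by (simp add: divide_simps) (use r v in algebra)
  show "pd / 2 + nd * v = - ((- d) + (u - d) + (c - d)) / (8 * (- d) * (u - d) * (c - d)) * (u - d - d * P)
        + (1 / (- d) + 1 / (u - d) + 1 / (c - d)) / 2 * v"
    unfolding nd_def pd_def using nz ne
    by (simp add: divide_simps) (use r v in algebra)
  show "- d * pd + nd * (u - d - d * P) = 3 / 2 * v"
    unfolding nd_def pd_def using nz ne
    by (simp add: divide_simps) (use r v in algebra)
qed

section \<open>Logarithmic derivatives and sums over simple roots\<close>

text \<open>Derivatives are written as value times a factor; for products these factors add, and no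
  division is involved.\<close>

lemma log_derivative_mult:
  fixes f g :: "complex \<Rightarrow> complex"
  assumes "(f has_field_derivative f x * l) (at x)" "(g has_field_derivative g x * m) (at x)"
  shows "((\<lambda>z. f z * g z) has_field_derivative (f x * g x) * (l + m)) (at x)"
  using DERIV_mult[OF assms] by (simp add: algebra_simps)

lemma log_derivative_power:
  fixes f :: "complex \<Rightarrow> complex"
  assumes "(f has_field_derivative f x * l) (at x)"
  shows "((\<lambda>z. f z ^ n) has_field_derivative f x ^ n * (of_nat n * l)) (at x)"
  using DERIV_power[OF assms, of n] by (cases n) (simp_all add: algebra_simps)

lemma log_derivative_diff:
  fixes f g :: "complex \<Rightarrow> complex"
  assumes "(f has_field_derivative f') (at x)" "(g has_field_derivative g') (at x)" "f x \<noteq> g x"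
  shows "((\<lambda>z. f z - g z) has_field_derivative (f x - g x) * ((f' - g') / (f x - g x))) (at x)"
  using DERIV_diff[OF assms(1,2)] assms(3) by simp

text \<open>The vanishing root sum turns the sum of the differences into - 4 e and their second
  symmetric function into 2 (3 e^2 + h), while their product is - 1 / D. This rewrites the
  coefficients of \<open>period_partials\<close> as polynomials in the root times its
  derivative.\<close>

lemma simple_root_sums:
  fixes e :: complex
  assumes "e + x + y + z = 0" "2 * h = e * x + e * y + e * z + x * y + x * z + y * z"
    "(e - x) * (e - y) * (e - z) * D = 1"
  shows "- ((x - e) + (y - e) + (z - e)) / (8 * (x - e) * (y - e) * (z - e)) = - e * D / 2"
    "(1 / (x - e) + 1 / (y - e) + 1 / (z - e)) / 2 = - (3 * e\<^sup>2 + h) * D"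
proof -
  have nz: "x - e \<noteq> 0" "y - e \<noteq> 0" "z - e \<noteq> 0" using assms(3) by auto
  define M where "M = (x - e) * (y - e) * (z - e)"
  have "M * D = - 1" using assms(3) unfolding M_def by algebra
  then have "M \<noteq> 0" by auto
  then have "D = - 1 / M"
    using \<open>M * D = - 1\<close> by (subst nonzero_eq_divide_eq) (simp_all add: mult.commute)
  note D = this
  have "(x - e) + (y - e) + (z - e) = - 4 * e" using assms(1) by algebra
  moreover have "8 * (x - e) * (y - e) * (z - e) = 8 * M" by (simp add: M_def)
  ultimately show "- ((x - e) + (y - e) + (z - e)) / (8 * (x - e) * (y - e) * (z - e)) = - e * D / 2"
    unfolding D by (simp only:) (simp add: field_simps)
  have "(1 / p + 1 / q + 1 / r) * (p * q * r) = q * r + p * r + p * q"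
    if "p \<noteq> 0" "q \<noteq> 0" "r \<noteq> 0" for p q r :: complex using that by (simp add: field_simps)
  from this[OF nz] have "(1 / (x - e) + 1 / (y - e) + 1 / (z - e)) * M
      = (y - e) * (z - e) + (x - e) * (z - e) + (x - e) * (y - e)" by (simp only: M_def)
  also have "\<dots> = 2 * (3 * e\<^sup>2 + h)" using assms(1,2) by algebra
  finally show "(1 / (x - e) + 1 / (y - e) + 1 / (z - e)) / 2 = - (3 * e\<^sup>2 + h) * D"
    unfolding D using \<open>M \<noteq> 0\<close> by (simp add: field_simps)
qed

text \<open>Here k is a square root of \<open>\<beta> / \<alpha>\<close>, so the sum is \<alpha> (1
  + k)^2, and its derivative \<alpha> (l + k^2 m + k l + k m) factors as \<alpha> (1 + k) (l + k
  m).\<close>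

lemma log_derivative_sqrt_sum:
  fixes \<alpha> \<beta> p :: "complex \<Rightarrow> complex"
  assumes p2: "p x ^ 2 = \<alpha> x * \<beta> x" and nz: "\<alpha> x \<noteq> 0" "\<beta> x \<noteq> 0" "1 + k \<noteq> 0"
    and k: "p x = k * \<alpha> x"
    and D: "(\<alpha> has_field_derivative \<alpha> x * l) (at x)" "(\<beta> has_field_derivative \<beta> x * m) (at x)"
    "(p has_field_derivative p x * ((l + m) / 2)) (at x)"
  shows "((\<lambda>z. \<alpha> z + \<beta> z + 2 * p z) has_field_derivative
      (\<alpha> x + \<beta> x + 2 * p x) * ((l + k * m) / (1 + k))) (at x)"
proof -
  have b: "\<beta> x = k\<^sup>2 * \<alpha> x" using p2 k nz by algebra
  show ?thesis
    by (rule derivative_eq_intros D refl)+ (use nz in \<open>simp add: b k field_simps power2_eq_square\<close>)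
qed

text \<open>The difference of the two products factors as (a - b)(d - c). For four distinct points
  the cross ratio is thus not 1, which keeps 1 + k away from 0.\<close>

lemma root_products_distinct:
  fixes a b c d :: complex
  assumes "a \<noteq> b" "c \<noteq> d"
  shows "(c - b) * (d - a) \<noteq> (d - b) * (c - a)"
proof
  assume "(c - b) * (d - a) = (d - b) * (c - a)"
  then have "(a - b) * (d - c) = 0" by algebra
  then show False using assms by simp
qed

section \<open>The derivative of one column along the curve of roots\<close>

text \<open>\<open>P\<close> and \<open>N\<close> are given by the algebraic equations
  \<open>P2\<close> and \<open>N4\<close>, so differentiating these yields their logarithmic
  derivatives. Sorted by the moving root, they are combinations of the partials in
  \<open>period_partials\<close>. Through \<open>simple_root_sums\<close> each partial contains a
  second factor of the root derivative, whence the squares.\<close>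

lemma column_derivative:
  fixes a b c d N P :: "complex \<Rightarrow> complex" and x :: complex
  assumes "open U" "x \<in> U"
    and D: "(a has_field_derivative a') (at x)" "(b has_field_derivative b') (at x)"
      "(c has_field_derivative c') (at x)" "(d has_field_derivative d') (at x)"
    and DN: "N field_differentiable at x" and DP: "P field_differentiable at x"
    and ne: "a x \<noteq> b x" "a x \<noteq> c x" "a x \<noteq> d x" "b x \<noteq> c x" "b x \<noteq> d x" "c x \<noteq> d x"
    and P2: "\<And>z. z \<in> U \<Longrightarrow> P z ^ 2 * ((c z - a z) * (d z - a z)) = (c z - b z) * (d z - b z)"
    and N4: "\<And>z. z \<in> U \<Longrightarrow> N z ^ 4 * (((c z - b z) * (d z - b z)) ^ 2 *
        ((c z - b z) * (d z - a z) + (d z - b z) * (c z - a z) + 2 * (P z * ((c z - a z) * (d z - a z))))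
        * (b z - a z) ^ 2) = - 4"
    and sum0: "\<And>z. z \<in> U \<Longrightarrow> a z + b z + c z + d z = 0"
    and h: "2 * h = a x * b x + a x * c x + a x * d x + b x * c x + b x * d x + c x * d x"
    and inv: "(a x - b x) * (a x - c x) * (a x - d x) * a' = 1"
      "(b x - a x) * (b x - c x) * (b x - d x) * b' = 1"
      "(c x - a x) * (c x - b x) * (c x - d x) * c' = 1"
      "(d x - a x) * (d x - b x) * (d x - c x) * d' = 1"
  defines "X \<equiv> N x * (b x + a x * P x)" and "Y \<equiv> N x * ((1 + P x) / 2)"
  shows "((\<lambda>z. N z * ((1 + P z) / 2)) has_field_derivative
      - ((a x * a'\<^sup>2 + b x * b'\<^sup>2 + c x * c'\<^sup>2 + d x * d'\<^sup>2) / 2 * X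
        + ((2 * (a x)\<^sup>2 + h) * a'\<^sup>2 + (2 * (b x)\<^sup>2 + h) * b'\<^sup>2 + (2 * (c x)\<^sup>2 + h) * c'\<^sup>2
          + (2 * (d x)\<^sup>2 + h) * d'\<^sup>2) * Y)) (at x)"
    "((\<lambda>z. N z * (b z + a z * P z)) has_field_derivative
      - (((a x)\<^sup>2 * a'\<^sup>2 + (b x)\<^sup>2 * b'\<^sup>2 + (c x)\<^sup>2 * c'\<^sup>2 + (d x)\<^sup>2 * d'\<^sup>2) * X
        + (2 * a x * (2 * (a x)\<^sup>2 + h) * a'\<^sup>2 + 2 * b x * (2 * (b x)\<^sup>2 + h) * b'\<^sup>2
          + 2 * c x * (2 * (c x)\<^sup>2 + h) * c'\<^sup>2 + 2 * d x * (2 * (d x)\<^sup>2 + h) * d'\<^sup>2) * Y)) (at x)"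
proof -
  note sum = sum0[OF \<open>x \<in> U\<close>]
  \<comment> \<open>Since \<open>\<alpha> * \<beta> = R * S\<close>, the product
    \<open>p = P * R\<close> is a square root of \<open>\<alpha> * \<beta>\<close>, and
    \<open>k\<close> one of the cross ratio \<open>\<beta> / \<alpha>\<close>.\<close>
  define \<alpha> where "\<alpha> = (\<lambda>z. (c z - b z) * (d z - a z))"
  define \<beta> where "\<beta> = (\<lambda>z. (d z - b z) * (c z - a z))"
  define R where "R = (\<lambda>z. (c z - a z) * (d z - a z))"
  define S where "S = (\<lambda>z. (c z - b z) * (d z - b z))"
  define p where "p = (\<lambda>z. P z * R z)"
  define k where "k = p x / \<alpha> x"
  have nz: "\<alpha> x \<noteq> 0" "\<beta> x \<noteq> 0" "R x \<noteq> 0" "S x \<noteq> 0"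
    using ne by (auto simp: \<alpha>_def \<beta>_def R_def S_def)
  have P2x: "P x ^ 2 * R x = S x" using P2[OF \<open>x \<in> U\<close>] by (simp add: R_def S_def)
  have "P x \<noteq> 0" using P2x nz by auto
  have p2: "p x ^ 2 = \<alpha> x * \<beta> x"
    using P2x unfolding p_def \<alpha>_def \<beta>_def R_def S_def by algebra
  have "\<alpha> x \<noteq> \<beta> x" using root_products_distinct[OF ne(1,6)] by (simp add: \<alpha>_def \<beta>_def)
  have k: "p x = k * \<alpha> x" using nz by (simp add: k_def)
  have k1: "1 + k \<noteq> 0"
  proof
    assume "1 + k = 0"
    then have "p x = - \<alpha> x" using k by (simp add: add_eq_0_iff)
    then have "\<alpha> x * \<alpha> x = \<alpha> x * \<beta> x" using p2 by (simp add: power2_eq_square)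
    then show False using nz \<open>\<alpha> x \<noteq> \<beta> x\<close> by simp
  qed

  define lu where "lu = (b' - a') / (b x - a x)"
  define lca where "lca = (c' - a') / (c x - a x)"
  define lda where "lda = (d' - a') / (d x - a x)"
  define lcb where "lcb = (c' - b') / (c x - b x)"
  define ldb where "ldb = (d' - b') / (d x - b x)"
  note Ddiff = log_derivative_diff[OF D(2,1), folded lu_def] log_derivative_diff[OF D(3,1), folded lca_def]
    log_derivative_diff[OF D(4,1), folded lda_def] log_derivative_diff[OF D(3,2), folded lcb_def]
    log_derivative_diff[OF D(4,2), folded ldb_def]
  have Du: "((\<lambda>z. b z - a z) has_field_derivative (b x - a x) * lu) (at x)"
    and Dca: "((\<lambda>z. c z - a z) has_field_derivative (c x - a x) * lca) (at x)"
    and Dda: "((\<lambda>z. d z - a z) has_field_derivative (d x - a x) * lda) (at x)"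
    and Dcb: "((\<lambda>z. c z - b z) has_field_derivative (c x - b x) * lcb) (at x)"
    and Ddb: "((\<lambda>z. d z - b z) has_field_derivative (d x - b x) * ldb) (at x)"
    using Ddiff ne by auto
  have D\<alpha>: "(\<alpha> has_field_derivative \<alpha> x * (lcb + lda)) (at x)"
    using log_derivative_mult[OF Dcb Dda] by (simp add: \<alpha>_def)
  have D\<beta>: "(\<beta> has_field_derivative \<beta> x * (ldb + lca)) (at x)"
    using log_derivative_mult[OF Ddb Dca] by (simp add: \<beta>_def)
  have DR: "(R has_field_derivative R x * (lca + lda)) (at x)"
    using log_derivative_mult[OF Dca Dda] by (simp add: R_def)
  have DS: "(S has_field_derivative S x * (lcb + ldb)) (at x)"
    using log_derivative_mult[OF Dcb Ddb] by (simp add: S_def)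

  obtain P' where P': "(P has_field_derivative P') (at x)"
    using DP by (auto simp: field_differentiable_def)
  define lP where "lP = P' / P x"
  have DP: "(P has_field_derivative P x * lP) (at x)" using P' \<open>P x \<noteq> 0\<close> by (simp add: lP_def)
  \<comment> \<open>Differentiating P^2 R = S in two ways determines \<open>lP\<close>.\<close>
  have "((\<lambda>z. P z ^ 2 * R z) has_field_derivative (P x ^ 2 * R x) * (2 * lP + (lca + lda))) (at x)"
    using log_derivative_mult[OF log_derivative_power[OF DP, of 2] DR] by simp
  then have "(S has_field_derivative (P x ^ 2 * R x) * (2 * lP + (lca + lda))) (at x)"
    by (rule has_field_derivative_transform_within_open[OF _ \<open>open U\<close> \<open>x \<in> U\<close>])
      (use P2 in \<open>simp add: R_def S_def\<close>)
  from DERIV_unique[OF this DS] have "2 * lP + (lca + lda) = lcb + ldb"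
    using P2x nz by simp
  then have lP: "lP = (lcb + ldb - lca - lda) / 2" by (simp add: field_simps)
  have Dp: "(p has_field_derivative p x * (((lcb + lda) + (ldb + lca)) / 2)) (at x)"
    using log_derivative_mult[OF DP DR] by (simp add: p_def lP field_simps)
  define lX where "lX = (lcb + lda + k * (ldb + lca)) / (1 + k)"
  have DX: "((\<lambda>z. \<alpha> z + \<beta> z + 2 * p z) has_field_derivative (\<alpha> x + \<beta> x + 2 * p x) * lX) (at x)"
    unfolding lX_def by (rule log_derivative_sqrt_sum[OF p2 nz(1,2) k1 k D\<alpha> D\<beta> Dp])

  obtain N' where N': "(N has_field_derivative N') (at x)"
    using DN by (auto simp: field_differentiable_def)
  \<comment> \<open>\<open>N ^ 4 * K\<close> is the constant - 4, so four times the logarithmic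
    derivative of \<open>N\<close> cancels that of \<open>K\<close>.\<close>
  define K where "K = (\<lambda>z. S z ^ 2 * (\<alpha> z + \<beta> z + 2 * p z) * (b z - a z) ^ 2)"
  have N4': "N z ^ 4 * K z = - 4" if "z \<in> U" for z
    using N4[OF that] by (simp add: K_def S_def \<alpha>_def \<beta>_def p_def R_def)
  have "N x \<noteq> 0" using N4'[OF \<open>x \<in> U\<close>] by auto
  define l where "l = N' / N x"
  have DN: "(N has_field_derivative N x * l) (at x)" using N' \<open>N x \<noteq> 0\<close> by (simp add: l_def)
  have DK: "(K has_field_derivative K x * (2 * (lcb + ldb) + lX + 2 * lu)) (at x)"
    unfolding K_def
    using log_derivative_mult[OF log_derivative_mult[OF log_derivative_power[OF DS, of 2] DX]
        log_derivative_power[OF Du, of 2]] by simp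
  have "((\<lambda>z. N z ^ 4 * K z) has_field_derivative
      (N x ^ 4 * K x) * (4 * l + (2 * (lcb + ldb) + lX + 2 * lu))) (at x)"
    using log_derivative_mult[OF log_derivative_power[OF DN, of 4] DK] by simp
  then have "((\<lambda>z. - 4) has_field_derivative (- 4) * (4 * l + (2 * (lcb + ldb) + lX + 2 * lu))) (at x)"
    unfolding N4'[OF \<open>x \<in> U\<close>]
    by (rule has_field_derivative_transform_within_open[OF _ \<open>open U\<close> \<open>x \<in> U\<close>]) (use N4' in simp)
  from DERIV_unique[OF this DERIV_const] have "4 * l + (2 * (lcb + ldb) + lX + 2 * lu) = 0"
    by (simp only: mult_eq_0_iff neg_equal_0_iff_equal) simp
  then have l: "l = - (2 * (lcb + ldb) + 2 * lu + lX) / 4" by algebra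

  \<comment> \<open>The partials were computed with \<open>a\<close> moved to the origin.
    \<open>u\<close>, \<open>r\<close>, \<open>s\<close> are the other roots after this shift, and
    the column is \<open>N\<close> times (\<open>w\<close>, \<open>v\<close>).\<close>
  define u where "u = b x - a x"
  define r where "r = c x - a x"
  define s where "s = d x - a x"
  define v where "v = (1 + P x) / 2"
  define w where "w = b x + a x * P x"
  have shift: "b x = a x + u" "c x = a x + r" "d x = a x + s" by (simp_all add: u_def r_def s_def)
  have nz': "u \<noteq> 0" "r \<noteq> 0" "s \<noteq> 0" "r \<noteq> u" "s \<noteq> u" "r \<noteq> s"
    using ne by (auto simp: u_def r_def s_def)
  have "P x * ((c x - a x) * (d x - a x)) = k * ((c x - b x) * (d x - a x))"
    using k by (simp add: p_def R_def \<alpha>_def)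
  then have kP1: "P x * r = k * (r - u)" using ne by (simp add: r_def u_def)
  have "\<alpha> x * (k * P x * s) = P x * p x * s" using k by simp
  also have "\<dots> = \<alpha> x * (s - u)"
    using P2x unfolding p_def R_def \<alpha>_def S_def s_def u_def by algebra
  finally have kP2: "k * P x * s = s - u" using nz(1) by (simp only: mult_cancel_left simp_thms)
  define pa where "pa = P x / 2 * (1 / r + 1 / s)"
  define na where "na = - (- 2 / u + (- 1 / s - k / r) / (1 + k)) / 4"
  define pb where "pb = - P x / 2 * (1 / (r - u) + 1 / (s - u))"
  define nb where "nb = - (2 * (- 1 / (r - u) - 1 / (s - u)) + 2 / u + (- 1 / (r - u) - k / (s - u)) / (1 + k)) / 4"
  define pc where "pc = P x / 2 * (1 / (r - u) - 1 / r)"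
  define nc where "nc = - (2 / (r - u) + (1 / (r - u) + k / r) / (1 + k)) / 4"
  define pd where "pd = P x / 2 * (1 / (s - u) - 1 / s)"
  define nd where "nd = - (2 / (s - u) + (1 / s + k / (s - u)) / (1 + k)) / 4"
  have ru: "r - u = c x - b x" "s - u = d x - b x" by (simp_all add: r_def s_def u_def)
  \<comment> \<open>With names for the reciprocals, the two chain-rule identities
    \<open>P'_eq\<close> and \<open>l_eq\<close> become polynomial up to numerical factors.\<close>
  define ica ida icb idb iu ik where "ica = 1 / r" and "ida = 1 / s"
    and "icb = 1 / (r - u)" and "idb = 1 / (s - u)" and "iu = 1 / u" and "ik = 1 / (1 + k)"
  have ls: "lca = (c' - a') * ica" "lda = (d' - a') * ida" "lcb = (c' - b') * icb"
    "ldb = (d' - b') * idb" "lu = (b' - a') * iu"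
    by (simp_all add: lca_def lda_def lcb_def ldb_def lu_def ica_def ida_def icb_def idb_def iu_def ru)
      (simp_all add: r_def s_def u_def)
  have P'_eq: "P x * lP = a' * pa + b' * pb + c' * pc + d' * pd"
  proof -
    have "pa = P x / 2 * (ica + ida)" "pb = - P x / 2 * (icb + idb)"
      "pc = P x / 2 * (icb - ica)" "pd = P x / 2 * (idb - ida)"
      unfolding pa_def pb_def pc_def pd_def ica_def ida_def icb_def idb_def by simp_all
    then show ?thesis unfolding lP ls by (simp only:) (simp add: field_simps)
  qed
  have l_eq: "l = a' * na + b' * nb + c' * nc + d' * nd"
  proof -
    have "na = - (- 2 * iu + (- ida - k * ica) * ik) / 4"
      "nb = - (2 * (- icb - idb) + 2 * iu + (- icb - k * idb) * ik) / 4"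
      "nc = - (2 * icb + (icb + k * ica) * ik) / 4" "nd = - (2 * idb + (ida + k * idb) * ik) / 4"
      unfolding na_def nb_def nc_def nd_def ica_def ida_def icb_def idb_def iu_def ik_def by simp_all
    moreover have "lX = (lcb + lda + k * (ldb + lca)) * ik" by (simp add: lX_def ik_def)
    ultimately show ?thesis unfolding l ls by (simp only:) (simp add: field_simps)
  qed
  note partials = period_partials[OF nz' k1 kP1 kP2, of v, folded pa_def na_def pb_def nb_def pc_def nc_def pd_def nd_def]
  have v2: "2 * v = 1 + P x" by (simp add: v_def)

  have sums: "- (u + r + s) / (8 * u * r * s) = - a x * a' / 2" "(1 / u + 1 / r + 1 / s) / 2 = - (3 * (a x)\<^sup>2 + h) * a'"
    "- ((- u) + (r - u) + (s - u)) / (8 * (- u) * (r - u) * (s - u)) = - b x * b' / 2"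
    "(1 / (- u) + 1 / (r - u) + 1 / (s - u)) / 2 = - (3 * (b x)\<^sup>2 + h) * b'"
    "- ((- r) + (u - r) + (s - r)) / (8 * (- r) * (u - r) * (s - r)) = - c x * c' / 2"
    "(1 / (- r) + 1 / (u - r) + 1 / (s - r)) / 2 = - (3 * (c x)\<^sup>2 + h) * c'"
    "- ((- s) + (u - s) + (r - s)) / (8 * (- s) * (u - s) * (r - s)) = - d x * d' / 2"
    "(1 / (- s) + 1 / (u - s) + 1 / (r - s)) / 2 = - (3 * (d x)\<^sup>2 + h) * d'"
    using simple_root_sums[of "a x" "b x" "c x" "d x" h a'] simple_root_sums[of "b x" "a x" "c x" "d x" h b']
      simple_root_sums[of "c x" "a x" "b x" "d x" h c'] simple_root_sums[of "d x" "a x" "b x" "c x" h d']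
      sum h inv
    by (simp_all add: u_def r_def s_def algebra_simps)
  \<comment> \<open>Undoing the shift: the factor that goes with a root e in \<open>partials\<close>
    is \<open>w\<close> - 2 e \<open>v\<close>.\<close>
  have wa: "u = w - 2 * a x * v" "- (u * P x) = w - 2 * b x * v"
    "u - r - r * P x = w - 2 * c x * v" "u - s - s * P x = w - 2 * d x * v"
    unfolding w_def u_def r_def s_def v_def by (simp_all add: field_simps)
  \<comment> \<open>Expanding \<open>w\<close> - 2 e \<open>v\<close> lowers the coefficient 3 e^2 +
    h of \<open>v\<close> to 2 e^2 + h.\<close>
  have ra: "pa / 2 + na * v = - (a x * a' / 2 * w + (2 * (a x)\<^sup>2 + h) * a' * v)"
    using partials(1)[OF v2] wa(1) unfolding sums by (simp add: algebra_simps power2_eq_square)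
  have rb: "pb / 2 + nb * v = - (b x * b' / 2 * w + (2 * (b x)\<^sup>2 + h) * b' * v)"
    using partials(3)[OF v2] unfolding sums wa(2) by (simp add: algebra_simps power2_eq_square)
  have rc: "pc / 2 + nc * v = - (c x * c' / 2 * w + (2 * (c x)\<^sup>2 + h) * c' * v)"
    using partials(5)[OF v2] unfolding sums wa(3) by (simp add: algebra_simps power2_eq_square)
  have rd: "pd / 2 + nd * v = - (d x * d' / 2 * w + (2 * (d x)\<^sup>2 + h) * d' * v)"
    using partials(7)[OF v2] unfolding sums wa(4) by (simp add: algebra_simps power2_eq_square)
  have row2: "P x * lP / 2 + l * v = - ((a x * a'\<^sup>2 + b x * b'\<^sup>2 + c x * c'\<^sup>2 + d x * d'\<^sup>2) / 2 * w
        + ((2 * (a x)\<^sup>2 + h) * a'\<^sup>2 + (2 * (b x)\<^sup>2 + h) * b'\<^sup>2 + (2 * (c x)\<^sup>2 + h) * c'\<^sup>2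
          + (2 * (d x)\<^sup>2 + h) * d'\<^sup>2) * v)"
  proof -
    have "P x * lP / 2 + l * v = a' * (pa / 2 + na * v) + b' * (pb / 2 + nb * v)
        + c' * (pc / 2 + nc * v) + d' * (pd / 2 + nd * v)"
      unfolding P'_eq l_eq by (simp add: field_simps)
    also have "\<dots> = - ((a x * a'\<^sup>2 + b x * b'\<^sup>2 + c x * c'\<^sup>2 + d x * d'\<^sup>2) / 2 * w
        + ((2 * (a x)\<^sup>2 + h) * a'\<^sup>2 + (2 * (b x)\<^sup>2 + h) * b'\<^sup>2 + (2 * (c x)\<^sup>2 + h) * c'\<^sup>2
          + (2 * (d x)\<^sup>2 + h) * d'\<^sup>2) * v)"
      unfolding ra rb rc rd by (simp add: field_simps power2_eq_square)
    finally show ?thesis .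
  qed

  \<comment> \<open>The root derivatives add up to zero; this cancels the summand 3/2
    \<open>v\<close> that appears with every root in the first component.\<close>
  have "((\<lambda>z. a z + b z + c z + d z) has_field_derivative a' + b' + c' + d') (at x)"
    by (rule derivative_intros D)+
  then have "((\<lambda>z. 0) has_field_derivative a' + b' + c' + d') (at x)"
    by (rule has_field_derivative_transform_within_open[OF _ \<open>open U\<close> \<open>x \<in> U\<close>]) (use sum0 in simp)
  from DERIV_unique[OF this DERIV_const] have sum': "a' + b' + c' + d' = 0" .
  \<comment> \<open>For each root e, the partial of the first component is 2 e times that of the
    second plus the common summand 3/2 \<open>v\<close>, all up to the factor
    \<open>N\<close>.\<close>
  have qa: "P x + a x * pa + na * w = 2 * a x * (pa / 2 + na * v) + 3 / 2 * v"
  proof -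
    have "w = 2 * a x * v + u" using wa(1) by simp
    then show ?thesis using partials(2)[OF v2] by (simp add: algebra_simps)
  qed
  have qb: "1 + a x * pb + nb * w = 2 * b x * (pb / 2 + nb * v) + 3 / 2 * v"
    using partials(4)[OF v2] unfolding wa(2) by (simp add: shift field_simps)
  have qc: "a x * pc + nc * w = 2 * c x * (pc / 2 + nc * v) + 3 / 2 * v"
    using partials(6)[OF v2] unfolding wa(3) by (simp add: shift field_simps)
  have qd: "a x * pd + nd * w = 2 * d x * (pd / 2 + nd * v) + 3 / 2 * v"
    using partials(8)[OF v2] unfolding wa(4) by (simp add: shift field_simps)
  have row1: "b' + a' * P x + a x * (P x * lP) + l * w
      = - (((a x)\<^sup>2 * a'\<^sup>2 + (b x)\<^sup>2 * b'\<^sup>2 + (c x)\<^sup>2 * c'\<^sup>2 + (d x)\<^sup>2 * d'\<^sup>2) * w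
        + (2 * a x * (2 * (a x)\<^sup>2 + h) * a'\<^sup>2 + 2 * b x * (2 * (b x)\<^sup>2 + h) * b'\<^sup>2
          + 2 * c x * (2 * (c x)\<^sup>2 + h) * c'\<^sup>2 + 2 * d x * (2 * (d x)\<^sup>2 + h) * d'\<^sup>2) * v)"
  proof -
    have "b' + a' * P x + a x * (P x * lP) + l * w = a' * (P x + a x * pa + na * w)
        + b' * (1 + a x * pb + nb * w) + c' * (a x * pc + nc * w) + d' * (a x * pd + nd * w)"
      unfolding P'_eq l_eq by (simp add: field_simps)
    also have "\<dots> = a' * (2 * a x * (pa / 2 + na * v)) + b' * (2 * b x * (pb / 2 + nb * v))
        + c' * (2 * c x * (pc / 2 + nc * v)) + d' * (2 * d x * (pd / 2 + nd * v))
        + (a' + b' + c' + d') * (3 / 2 * v)"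
      unfolding qa qb qc qd by (simp only: distrib_left distrib_right add_ac)
    also have "\<dots> = - (((a x)\<^sup>2 * a'\<^sup>2 + (b x)\<^sup>2 * b'\<^sup>2 + (c x)\<^sup>2 * c'\<^sup>2 + (d x)\<^sup>2 * d'\<^sup>2) * w
        + (2 * a x * (2 * (a x)\<^sup>2 + h) * a'\<^sup>2 + 2 * b x * (2 * (b x)\<^sup>2 + h) * b'\<^sup>2
          + 2 * c x * (2 * (c x)\<^sup>2 + h) * c'\<^sup>2 + 2 * d x * (2 * (d x)\<^sup>2 + h) * d'\<^sup>2) * v)"
      unfolding ra rb rc rd sum' by (simp add: field_simps power2_eq_square)
    finally show ?thesis .
  qed

  have "((\<lambda>z. N z * ((1 + P z) / 2)) has_field_derivative N x * (P x * lP / 2 + l * v)) (at x)"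
    by (rule derivative_eq_intros DN DP refl | simp)+ (simp add: v_def field_simps)
  then show "((\<lambda>z. N z * ((1 + P z) / 2)) has_field_derivative
      - ((a x * a'\<^sup>2 + b x * b'\<^sup>2 + c x * c'\<^sup>2 + d x * d'\<^sup>2) / 2 * X
        + ((2 * (a x)\<^sup>2 + h) * a'\<^sup>2 + (2 * (b x)\<^sup>2 + h) * b'\<^sup>2 + (2 * (c x)\<^sup>2 + h) * c'\<^sup>2
          + (2 * (d x)\<^sup>2 + h) * d'\<^sup>2) * Y)) (at x)"
    unfolding row2 X_def Y_def v_def[symmetric] w_def[symmetric]
    by (simp only: minus_mult_right[symmetric] distrib_left mult.left_commute[of "N x"])
  have "((\<lambda>z. N z * (b z + a z * P z)) has_field_derivative
      N x * (b' + a' * P x + a x * (P x * lP) + l * w)) (at x)"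
    by (rule derivative_eq_intros DN DP D refl | simp)+ (simp add: w_def field_simps)
  then show "((\<lambda>z. N z * (b z + a z * P z)) has_field_derivative
      - (((a x)\<^sup>2 * a'\<^sup>2 + (b x)\<^sup>2 * b'\<^sup>2 + (c x)\<^sup>2 * c'\<^sup>2 + (d x)\<^sup>2 * d'\<^sup>2) * X
        + (2 * a x * (2 * (a x)\<^sup>2 + h) * a'\<^sup>2 + 2 * b x * (2 * (b x)\<^sup>2 + h) * b'\<^sup>2
          + 2 * c x * (2 * (c x)\<^sup>2 + h) * c'\<^sup>2 + 2 * d x * (2 * (d x)\<^sup>2 + h) * d'\<^sup>2) * Y)) (at x)"
    unfolding row1 X_def Y_def v_def[symmetric] w_def[symmetric]
    by (simp only: minus_mult_right[symmetric] distrib_left mult.left_commute[of "N x"])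
qed

section \<open>Critical points and the Fuchsian matrix\<close>

lemma lagrange_interpolation:
  fixes x :: "'i \<Rightarrow> 'a :: field" and p :: "'a poly"
  assumes "finite I" "inj_on x I" "degree p < card I"
  shows "poly p z = (\<Sum>i\<in>I. poly p (x i) * (\<Prod>j\<in>I - {i}. (z - x j) / (x i - x j)))"
proof -
  define l where "l i = (\<Prod>j\<in>I - {i}. smult (1 / (x i - x j)) [:- x j, 1:])" for i
  have l: "poly (l i) z = (\<Prod>j\<in>I - {i}. (z - x j) / (x i - x j))" for i z
    by (simp add: l_def poly_prod diff_divide_distrib)
  define r where "r = (\<Sum>i\<in>I. smult (poly p (x i)) (l i))"
  have r: "poly r z = (\<Sum>i\<in>I. poly p (x i) * (\<Prod>j\<in>I - {i}. (z - x j) / (x i - x j)))" for z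
    by (simp add: r_def poly_sum l)
  have "degree (l i) \<le> card I - 1" if "i \<in> I" for i
  proof -
    have "degree (l i) \<le> (\<Sum>j\<in>I - {i}. degree (smult (1 / (x i - x j)) [:- x j, 1:]))"
      using degree_prod_sum_le[of "I - {i}" "\<lambda>j. smult (1 / (x i - x j)) [:- x j, 1:]"] assms(1)
      by (simp only: l_def o_def finite_Diff)
    also have "\<dots> \<le> (\<Sum>j\<in>I - {i}. 1)" by (intro sum_mono) simp
    also have "\<dots> = card I - 1" using that assms(1) by simp
    finally show ?thesis .
  qed
  then have "degree (smult (poly p (x i)) (l i)) \<le> card I - 1" if "i \<in> I" for i
    using order_trans[OF degree_smult_le] that by blast
  then have "degree r \<le> card I - 1"
    unfolding r_def by (rule degree_sum_le[OF assms(1)])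
  \<comment> \<open>The bound on \<open>degree p\<close> makes \<open>I\<close> nonempty, so the
    truncated \<open>card I - 1\<close> is strictly below \<open>card I\<close>.\<close>
  then have "degree r < card (x ` I)" "degree p < card (x ` I)"
    using assms by (auto simp: card_image)
  moreover have "poly p (x k) = poly r (x k)" if "k \<in> I" for k
  proof -
    have "poly p (x i) * (\<Prod>j\<in>I - {i}. (x k - x j) / (x i - x j)) = (if i = k then poly p (x k) else 0)"
      if "i \<in> I" for i
    proof (cases "i = k")
      case True
      have "(\<Prod>j\<in>I - {i}. (x k - x j) / (x i - x j)) = 1"
        using True \<open>i \<in> I\<close> inj_onD[OF assms(2)] by (intro prod.neutral ballI) (auto simp del: divide_eq_1_iff intro!: divide_self)
      then show ?thesis using True by simp
    next
      case False
      then have "(\<Prod>j\<in>I - {i}. (x k - x j) / (x i - x j)) = 0"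
        using \<open>k \<in> I\<close> assms(1) by (intro prod_zero bexI[of _ k]) simp_all
      then show ?thesis using False by simp
    qed
    then have "poly r (x k) = (\<Sum>i\<in>I. if i = k then poly p (x k) else 0)"
      unfolding r by (intro sum.cong) auto
    then show ?thesis using \<open>k \<in> I\<close> assms(1) by simp
  qed
  ultimately have "p = r" by (intro poly_eqI_degree[of "x ` I"]) auto
  then have "poly p z = poly r z" by (rule arg_cong)
  then show ?thesis by (rule trans[OF _ r])
qed

text \<open>\<open>D i\<close> is the reciprocal of the derivative of the product at its zero
  \<open>x i\<close>, so this is the interpolation formula divided by the product. The minus sign
  comes from writing the denominators as \<open>x i - z\<close>.\<close>

lemma lagrange_partial_fractions:
  fixes x :: "'i \<Rightarrow> 'a :: field"
  assumes "finite I" "inj_on x I" "degree p < card I" "\<And>i. i \<in> I \<Longrightarrow> z \<noteq> x i"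
    and D: "\<And>i. i \<in> I \<Longrightarrow> (\<Prod>j\<in>I - {i}. x i - x j) * D i = 1"
  shows "poly p z / (\<Prod>i\<in>I. z - x i) = - (\<Sum>i\<in>I. poly p (x i) * D i / (x i - z))"
proof -
  have nz: "(\<Prod>i\<in>I. z - x i) \<noteq> 0" using assms(1,4) by simp
  have "poly p (x i) * (\<Prod>j\<in>I - {i}. (z - x j) / (x i - x j))
      = - (poly p (x i) * D i / (x i - z)) * (\<Prod>i\<in>I. z - x i)" if "i \<in> I" for i
  proof -
    have A: "(\<Prod>j\<in>I - {i}. (z - x j) / (x i - x j)) = (\<Prod>j\<in>I - {i}. z - x j) * D i"
      using D[OF that] by (simp add: prod_dividef) (metis divide_inverse inverse_unique)
    have B': "(\<Prod>i\<in>I. z - x i) = (z - x i) * (\<Prod>j\<in>I - {i}. z - x j)"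
      using that assms(1) by (intro prod.remove)
    have "- (k / (x i - z)) * ((z - x i) * l) = k * l" for k l
    proof -
      define w where "w = x i - z"
      have "w \<noteq> 0" "z - x i = - w" using assms(4)[OF that] by (simp_all add: w_def)
      then show ?thesis by (simp add: w_def[symmetric])
    qed
    from this[of "poly p (x i) * D i" "\<Prod>j\<in>I - {i}. z - x j"] show ?thesis unfolding A B' by (simp only: mult_ac)
  qed
  then have "poly p z = - (\<Sum>i\<in>I. poly p (x i) * D i / (x i - z)) * (\<Prod>i\<in>I. z - x i)"
    unfolding lagrange_interpolation[OF assms(1-3), of z]
    by (simp add: sum_negf[symmetric] sum_distrib_right del: sum_negf)
  then show ?thesis using nz by (simp add: nonzero_divide_eq_eq)
qed

text \<open>Partial fractions are used twice. Over the roots, each quotient at a critical point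
  becomes a sum with one factor \<open>D i\<close>. Over the critical points, the weights then
  combine to 1 / ((x - c1)(x - c2)(x - c3)) at each root x, which is 4 \<open>D i\<close> and
  supplies the second factor.\<close>

lemma critical_point_sum:
  fixes x :: "'i \<Rightarrow> complex"
  assumes I: "finite I" "inj_on x I" "degree p < card I"
    and c: "c1 \<noteq> c2" "c1 \<noteq> c3" "c2 \<noteq> c3" "\<And>i. i \<in> I \<Longrightarrow> c1 \<noteq> x i" "\<And>i. i \<in> I \<Longrightarrow> c2 \<noteq> x i" "\<And>i. i \<in> I \<Longrightarrow> c3 \<noteq> x i"
    and D: "\<And>i. i \<in> I \<Longrightarrow> (\<Prod>j\<in>I - {i}. x i - x j) * D i = 1"
    and D': "\<And>i. i \<in> I \<Longrightarrow> 4 * ((x i - c1) * (x i - c2) * (x i - c3)) * D i = 1"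
  shows "poly p c1 / ((c1 - c2) * (c1 - c3)) / (\<Prod>i\<in>I. c1 - x i) + poly p c2 / ((c2 - c1) * (c2 - c3)) / (\<Prod>i\<in>I. c2 - x i)
      + poly p c3 / ((c3 - c1) * (c3 - c2)) / (\<Prod>i\<in>I. c3 - x i) = - 4 * (\<Sum>i\<in>I. poly p (x i) * (D i)\<^sup>2)"
proof -
  have part: "1 / ((c1 - c2) * (c1 - c3) * (x i - c1)) + 1 / ((c2 - c1) * (c2 - c3) * (x i - c2))
      + 1 / ((c3 - c1) * (c3 - c2) * (x i - c3)) = 4 * D i" if "i \<in> I" for i
  proof -
    have nz: "x i - c1 \<noteq> 0" "x i - c2 \<noteq> 0" "x i - c3 \<noteq> 0" "c1 - c2 \<noteq> 0" "c1 - c3 \<noteq> 0" "c2 - c3 \<noteq> 0"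
      "c2 - c1 \<noteq> 0" "c3 - c1 \<noteq> 0" "c3 - c2 \<noteq> 0"
      using c that by auto
    then have "1 / ((c1 - c2) * (c1 - c3) * (x i - c1)) + 1 / ((c2 - c1) * (c2 - c3) * (x i - c2))
      + 1 / ((c3 - c1) * (c3 - c2) * (x i - c3)) = 1 / ((x i - c1) * (x i - c2) * (x i - c3))"
      by (simp add: divide_simps) (simp add: algebra_simps)
    also have "\<dots> = 4 * D i"
      using D'[OF that] nz by (subst nonzero_divide_eq_eq) (simp_all only: mult_ac mult_eq_0_iff simp_thms)
    finally show ?thesis .
  qed
  have "poly p c / k / (\<Prod>i\<in>I. c - x i) = - (\<Sum>i\<in>I. poly p (x i) * D i * (1 / (k * (x i - c))))"
    if "\<And>i. i \<in> I \<Longrightarrow> c \<noteq> x i" for c k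
  proof -
    have "poly p c / k / (\<Prod>i\<in>I. c - x i) = poly p c / (\<Prod>i\<in>I. c - x i) / k" by (simp add: mult.commute)
    also have "\<dots> = - (\<Sum>i\<in>I. poly p (x i) * D i / (x i - c)) / k"
      using lagrange_partial_fractions[OF I that D] by simp
    also have "\<dots> = - (\<Sum>i\<in>I. poly p (x i) * D i * (1 / (k * (x i - c))))"
      by (simp add: sum_divide_distrib mult.commute)
    finally show ?thesis .
  qed
  then have "poly p c1 / ((c1 - c2) * (c1 - c3)) / (\<Prod>i\<in>I. c1 - x i) + poly p c2 / ((c2 - c1) * (c2 - c3)) / (\<Prod>i\<in>I. c2 - x i)
      + poly p c3 / ((c3 - c1) * (c3 - c2)) / (\<Prod>i\<in>I. c3 - x i)
    = - (\<Sum>i\<in>I. poly p (x i) * D i * (1 / ((c1 - c2) * (c1 - c3) * (x i - c1)) + 1 / ((c2 - c1) * (c2 - c3) * (x i - c2))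
      + 1 / ((c3 - c1) * (c3 - c2) * (x i - c3))))"
    using c by (simp only: distrib_left sum.distrib) simp
  also have "\<dots> = - (\<Sum>i\<in>I. poly p (x i) * D i * (4 * D i))"
    using part by (intro arg_cong[of _ _ uminus] sum.cong) simp_all
  also have "(\<Sum>i\<in>I. poly p (x i) * D i * (4 * D i)) = 4 * (\<Sum>i\<in>I. poly p (x i) * (D i)\<^sup>2)"
    by (simp add: sum_distrib_left power2_eq_square mult_ac)
  finally show ?thesis by simp
qed

section \<open>Coefficients and critical points of the quartic\<close>

lemma lambda_bar_coeffs:
  assumes "lambda_bar t q \<epsilon> = [:- a, 1:] * [:- b, 1:] * [:- c, 1:] * [:- d, 1:]"
  shows "a + b + c + d = 0"
    "a * b + a * c + a * d + b * c + b * d + c * d = - 2 * ((1 + t + t\<^sup>2) / q ^ 6)"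
    "a * b * c + a * b * d + a * c * d + b * c * d = - 4 * (t * (1 + t) / q ^ 9)"
proof -
  define m n where "m = t * (1 + t) / q ^ 9" and "n = (1 + t + t\<^sup>2) / q ^ 6"
  have "coeff (lambda_bar t q \<epsilon>) k = coeff ([:- a, 1:] * [:- b, 1:] * [:- c, 1:] * [:- d, 1:]) k" for k
    using assms by simp
  from this[of 3] this[of 2] this[of 1]
  have e: "- d - c - b - a = 0" "a * b + a * c + a * d + b * c + b * d + c * d = - 2 * n"
    "- (a * b * c + a * b * d + a * c * d + b * c * d) = 4 * m"
    unfolding lambda_bar_def m_def[symmetric] n_def[symmetric]
    by (simp_all add: numeral_3_eq_3 numeral_2_eq_2 algebra_simps) algebra+
  show "a + b + c + d = 0" using e(1) by algebra
  show "a * b + a * c + a * d + b * c + b * d + c * d = - 2 * ((1 + t + t\<^sup>2) / q ^ 6)"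
    using e(2) by (simp only: n_def)
  show "a * b * c + a * b * d + a * c * d + b * c * d = - 4 * (t * (1 + t) / q ^ 9)"
    using e(3) unfolding m_def[symmetric] by algebra
qed

text \<open>The first three facts are Vieta's formulas for a quarter of the derivative of the
  quartic, so \<open>c1\<close>, \<open>c2\<close>, \<open>c3\<close> are its critical points. The
  others say that the critical values at \<epsilon> = 0 are 0, 1 and s, the finite singular points
  of the system.\<close>

lemma lambda_bar_critical_points:
  assumes q: "q ^ 4 = 1 + 2 * t" "1 + 2 * t \<noteq> 0"
  defines "c1 \<equiv> - (1 + t) / q ^ 3" and "c2 \<equiv> t / q ^ 3" and "c3 \<equiv> 1 / q ^ 3"
  shows "c1 + c2 + c3 = 0" "c1 * c2 + c1 * c3 + c2 * c3 = - ((1 + t + t\<^sup>2) / q ^ 6)"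
    "c1 * c2 * c3 = - (t * (1 + t) / q ^ 9)"
    "poly (lambda_bar t q \<epsilon>) c1 = - \<epsilon>" "poly (lambda_bar t q \<epsilon>) c2 = 1 - \<epsilon>"
    "poly (lambda_bar t q \<epsilon>) c3 = t * (2 + t) ^ 3 / (1 + 2 * t) ^ 3 - \<epsilon>"
proof -
  \<comment> \<open>All denominators turn into powers of \<open>k\<close>; in particular (1 + 2 t)^3
    = q^12, so its reciprocal is k^4.\<close>
  define k where "k = 1 / q ^ 3"
  have "q \<noteq> 0" using q by auto
  have k: "c1 = - (1 + t) * k" "c2 = t * k" "c3 = k" by (simp_all add: c1_def c2_def c3_def k_def)
  have q6: "z / q ^ 6 = z * k\<^sup>2" "z / q ^ 9 = z * k ^ 3" for z by (simp_all add: k_def power_divide flip: power_mult)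
  have "(1 + 2 * t) ^ 3 = q ^ 12" unfolding q(1)[symmetric] by (simp flip: power_mult)
  then have q12: "z / (1 + 2 * t) ^ 3 = z * k ^ 4" for z by (simp add: k_def power_divide flip: power_mult)
  have k4: "k ^ 4 * (1 + 2 * t) ^ 3 = 1" using q12[of "(1 + 2 * t) ^ 3"] q(2) by (simp add: mult.commute)
  show "c1 + c2 + c3 = 0" "c1 * c2 + c1 * c3 + c2 * c3 = - ((1 + t + t\<^sup>2) / q ^ 6)"
    "c1 * c2 * c3 = - (t * (1 + t) / q ^ 9)"
    unfolding q6 k by algebra+
  show "poly (lambda_bar t q \<epsilon>) c1 = - \<epsilon>"
    unfolding lambda_bar_def q6 q12 k by simp algebra
  show "poly (lambda_bar t q \<epsilon>) c2 = 1 - \<epsilon>"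
    unfolding lambda_bar_def q6 q12 k using k4 by simp algebra
  show "poly (lambda_bar t q \<epsilon>) c3 = t * (2 + t) ^ 3 / (1 + 2 * t) ^ 3 - \<epsilon>"
    unfolding lambda_bar_def q6 q12 k by simp algebra
qed

section \<open>The columns in terms of the roots\<close>

text \<open>Near each point \<open>f\<close> and \<open>g\<close> are composites of one pair of
  germs with the curve (\<open>x\<close>, \<open>y\<close>), and inherit differentiability and both
  relations from it.\<close>

lemma fg_branch_on_relations:
  assumes "fg_branch_on U x y f g" "\<epsilon> \<in> U" "x field_differentiable at \<epsilon>" "y field_differentiable at \<epsilon>"
  shows "f field_differentiable at \<epsilon>" "g field_differentiable at \<epsilon>"
    "(2 * g \<epsilon> - f \<epsilon>)\<^sup>2 = (1 - x \<epsilon>) * (1 - y \<epsilon>) * (f \<epsilon>)\<^sup>2"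
    "((1 - x \<epsilon>) * (1 - y \<epsilon>))\<^sup>2 * f \<epsilon> ^ 3 * (4 * g \<epsilon> - (x \<epsilon> + y \<epsilon>) * f \<epsilon>) = 4"
proof -
  obtain F G where FG: "fg_branch (x \<epsilon>, y \<epsilon>) F G"
    and eq: "\<forall>\<^sub>F e in nhds \<epsilon>. f e = F (x e, y e) \<and> g e = G (x e, y e)"
    using assms(1,2) unfolding fg_branch_on_def by blast
  have "analytic2_at F (x \<epsilon>, y \<epsilon>)" "analytic2_at G (x \<epsilon>, y \<epsilon>)"
    using FG unfolding fg_branch_def continuation_along_def by (metis atLeastAtMost_iff order_refl zero_le_one)+
  then have d: "differentiable2 F (x \<epsilon>, y \<epsilon>)" "differentiable2 G (x \<epsilon>, y \<epsilon>)"
    unfolding analytic2_at_iff by (auto dest: eventually_nhds_x_imp_x)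
  have eqF: "\<forall>\<^sub>F e in nhds \<epsilon>. F (x e, y e) = f e" and eqG: "\<forall>\<^sub>F e in nhds \<epsilon>. G (x e, y e) = g e"
    using eq by (auto elim: eventually_mono)
  show "f field_differentiable at \<epsilon>"
    using differentiable2_compose[OF d(1) assms(3,4)] DERIV_cong_ev[OF refl eqF refl]
    by (auto simp: field_differentiable_def)
  show "g field_differentiable at \<epsilon>"
    using differentiable2_compose[OF d(2) assms(3,4)] DERIV_cong_ev[OF refl eqG refl]
    by (auto simp: field_differentiable_def)
  have v: "F (x \<epsilon>, y \<epsilon>) = f \<epsilon>" "G (x \<epsilon>, y \<epsilon>) = g \<epsilon>"
    using eventually_nhds_x_imp_x[OF eqF] eventually_nhds_x_imp_x[OF eqG] .
  have "fg_rel1 F G (x \<epsilon>, y \<epsilon>) = 0 \<and> fg_rel2 F G (x \<epsilon>, y \<epsilon>) = 0"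
    by (rule eventually_nhds_x_imp_x[OF fg_branch_relations[OF FG]])
  then show "(2 * g \<epsilon> - f \<epsilon>)\<^sup>2 = (1 - x \<epsilon>) * (1 - y \<epsilon>) * (f \<epsilon>)\<^sup>2"
    "((1 - x \<epsilon>) * (1 - y \<epsilon>))\<^sup>2 * f \<epsilon> ^ 3 * (4 * g \<epsilon> - (x \<epsilon> + y \<epsilon>) * f \<epsilon>) = 4"
    by (simp_all add: fg_rel1_def fg_rel2_def v)
qed

text \<open>\<open>P\<close> is chosen so that the first relation reads P^2 = (1 - x)(1 - y), where
  1 - x = (c - b) / (c - a) and 1 - y = (d - b) / (d - a). The second relation becomes the equation
  for \<open>N\<close> once the fourth power of the prefactor is taken into account.\<close>

lemma period_relations:
  fixes a b c d f g s r :: complex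
  assumes ne: "a \<noteq> b" "a \<noteq> c" "a \<noteq> d" "b \<noteq> c" "b \<noteq> d"
    and x: "x = (b - a) / (c - a)" and y: "y = (b - a) / (d - a)"
    and s: "s\<^sup>2 = b - a" and r: "r ^ 4 = (c - a) * (a - d)"
    and fg: "(2 * g - f)\<^sup>2 = (1 - x) * (1 - y) * f\<^sup>2"
      "((1 - x) * (1 - y))\<^sup>2 * f ^ 3 * (4 * g - (x + y) * f) = 4"
  defines "P \<equiv> (2 * g - f) / f" and "N \<equiv> f / (s * r ^ 3)"
  shows "f \<noteq> 0" "s \<noteq> 0" "r \<noteq> 0" "P\<^sup>2 * ((c - a) * (d - a)) = (c - b) * (d - b)"
    "N ^ 4 * (((c - b) * (d - b)) ^ 2 * ((c - b) * (d - a) + (d - b) * (c - a) + 2 * (P * ((c - a) * (d - a))))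
        * (b - a) ^ 2) = - 4"
    "1 / (s * r ^ 3) * ((b - a) * f + 2 * a * g) = N * (b + a * P)" "1 / (s * r ^ 3) * g = N * ((1 + P) / 2)"
proof -
  show f: "f \<noteq> 0" using fg(2) by auto
  show "s \<noteq> 0" "r \<noteq> 0" using s r ne by auto
  define ca da where "ca = c - a" and "da = d - a"
  have nz: "ca \<noteq> 0" "da \<noteq> 0" "b - a \<noteq> 0" using ne by (auto simp: ca_def da_def)
  have x1: "(1 - x) * ca = c - b" and y1: "(1 - y) * da = d - b"
    using nz unfolding x y by (simp_all add: ca_def da_def field_simps)
  have g: "2 * g = (1 + P) * f" using f by (simp add: P_def field_simps)
  have "(P * f)\<^sup>2 = (1 - x) * (1 - y) * f\<^sup>2" using fg(1) f by (simp add: P_def)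
  then have P2: "P\<^sup>2 = (1 - x) * (1 - y)" using f by (simp add: power_mult_distrib)
  then show "P\<^sup>2 * ((c - a) * (d - a)) = (c - b) * (d - b)"
    unfolding ca_def[symmetric] da_def[symmetric] x1[symmetric] y1[symmetric] by algebra
  have fP: "f ^ 4 * ((1 - x) * (1 - y))\<^sup>2 * ((1 - x) + (1 - y) + 2 * P) = 4"
  proof -
    have "4 * g - (x + y) * f = f * ((1 - x) + (1 - y) + 2 * P)" using g by algebra
    then show ?thesis using fg(2) by algebra
  qed
  have "f ^ 4 * (((c - b) * (d - b)) ^ 2 * ((c - b) * da + (d - b) * ca + 2 * (P * (ca * da))))
      = 4 * (ca * da) ^ 3"
  proof -
    have "f ^ 4 * ((k * ca * (l * da))\<^sup>2 * (k * ca * da + l * da * ca + 2 * (P * (ca * da))))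
        = f ^ 4 * (k * l)\<^sup>2 * (k + l + 2 * P) * (ca * da) ^ 3" for k l
      by algebra
    from this[of "1 - x" "1 - y"] show ?thesis unfolding x1 y1 fP .
  qed
  \<comment> \<open>The minus sign stems from a - d, instead of d - a, under the fourth root; it is
    the sign of the constant - 4.\<close>
  moreover have "(s * r ^ 3) ^ 4 = - ((b - a) ^ 2 * (ca * da) ^ 3)"
  proof -
    have "(s * r ^ 3) ^ 4 = (s\<^sup>2)\<^sup>2 * (r ^ 4) ^ 3" by (simp add: power_mult_distrib flip: power_mult)
    also have "\<dots> = - ((b - a) ^ 2 * (ca * da) ^ 3)" unfolding s r ca_def da_def by algebra
    finally show ?thesis .
  qed
  moreover have quot: "k / - (w * M) * (l * w) = - 4" if "k * l = 4 * M" "M \<noteq> 0" "w \<noteq> 0" for k l w M :: complex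
  proof -
    have "k / - (w * M) * (l * w) = - (k * l / M)" using that by (simp add: field_simps)
    then show ?thesis using that by simp
  qed
  ultimately show "N ^ 4 * (((c - b) * (d - b)) ^ 2 * ((c - b) * (d - a) + (d - b) * (c - a) + 2 * (P * ((c - a) * (d - a))))
        * (b - a) ^ 2) = - 4"
    unfolding N_def ca_def[symmetric] da_def[symmetric] power_divide using nz quot by simp
  show "1 / (s * r ^ 3) * ((b - a) * f + 2 * a * g) = N * (b + a * P)"
  proof -
    have "(b - a) * f + 2 * a * g = f * (b + a * P)" using g by algebra
    then show ?thesis by (simp add: N_def)
  qed
  show "1 / (s * r ^ 3) * g = N * ((1 + P) / 2)"
  proof -
    have "g = f * ((1 + P) / 2)" using g by (simp add: field_simps)
    then show ?thesis unfolding N_def by (metis mult.left_neutral times_divide_eq_left times_divide_eq_right)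
  qed
qed

section \<open>Independence of the two columns\<close>

text \<open>
  \<open>(b + a P) / (1 + P)\<close> is a fixed point of the involution of the projective line that swaps \<open>a\<close> with \<open>b\<close>
  and \<open>c\<close> with \<open>d\<close>. The involution for the other pairing has different fixed points.
\<close>

lemma involution_fixed_points_distinct:
  fixes a b c d P Q :: complex
  assumes ne: "a \<noteq> b" "a \<noteq> c" "a \<noteq> d" "b \<noteq> c" "b \<noteq> d" "c \<noteq> d"
    and P: "P\<^sup>2 * ((c - a) * (d - a)) = (c - b) * (d - b)"
    and Q: "Q\<^sup>2 * ((d - b) * (a - b)) = (d - c) * (a - c)"
  shows "(b + a * P) * (1 + Q) \<noteq> (c + b * Q) * (1 + P)"
proof
  assume eq: "(b + a * P) * (1 + Q) = (c + b * Q) * (1 + P)"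
  have "P \<noteq> 0" "Q \<noteq> 0" using P Q ne by auto
  have lin: "(a - b) * P * Q = - ((b - c) + (a - c) * P)" using eq by algebra
  then have "((a - b) * P * Q)\<^sup>2 * (d - b) = ((b - c) + (a - c) * P)\<^sup>2 * (d - b)" by algebra
  moreover have "((a - b) * P * Q)\<^sup>2 * (d - b) = (d - c) * (a - c) * (a - b) * P\<^sup>2" using Q by algebra
  ultimately have E: "((b - c) + (a - c) * P)\<^sup>2 * (d - b) = (d - c) * (a - c) * (a - b) * P\<^sup>2" by simp
  have "P\<^sup>2 * ((d - a) * (a - c)) = (b - c) * (d - b)" using P by algebra
  \<comment> \<open>Both \<open>E\<close> and the relation for \<open>P\<close> are quadratic in
    \<open>P\<close>. Modulo the latter, \<open>E\<close> reduces to a nonzero multiple of (b - c) +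
    (a - c) P, which by \<open>lin\<close> is minus the nonzero product (a - b) P Q.\<close>
  then have "2 * (d - b) * (b - c) * (d - a) * ((b - c) + (a - c) * P)
      = (d - a) * (((b - c) + (a - c) * P)\<^sup>2 * (d - b) - (d - c) * (a - c) * (a - b) * P\<^sup>2)"
    by algebra
  also have "\<dots> = 0" unfolding E by simp
  finally have "2 * (d - b) * (b - c) * (d - a) * ((b - c) + (a - c) * P) = 0" .
  then have "(b - c) + (a - c) * P = 0" using ne by simp
  then show False using lin \<open>P \<noteq> 0\<close> \<open>Q \<noteq> 0\<close> ne by simp
qed

section \<open>Residue matrices in terms of the critical points\<close>

text \<open>Here c is a critical point and k a quarter of the second derivative of the quartic
  there. The entries are the values at c of the polynomials that weigh the squared root derivatives
  in \<open>column_derivative\<close>, times \<open>\<mu>\<close> / k.\<close>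

definition residue_matrix :: "complex \<Rightarrow> complex \<Rightarrow> complex \<Rightarrow> complex^2^2" where
  "residue_matrix h k c = vector
    [vector [\<mu> * (c\<^sup>2 / k), \<mu> * (2 * c * (2 * c\<^sup>2 + h) / k)], vector [\<mu> * (c / 2 / k), \<mu> * ((2 * c\<^sup>2 + h) / k)]]"

text \<open>Each entry of \<open>B\<close> is a product of two entries of one row, so the square
  root \<open>W\<close> enters only through its square k q^6.\<close>

lemma B_row:
  assumes "\<Phi> $ i $ 1 = q ^ 3 / (2 * W)" "\<Phi> $ i $ 2 = m / W" "\<Phi> $ i $ 3 = n / (W * q ^ 3)"
    and "q \<noteq> 0" "W \<noteq> 0" "W\<^sup>2 = k * q ^ 6" "c = m / q ^ 3" "n = (2 * c\<^sup>2 + h) * q ^ 6"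
  shows "B \<Phi> i = residue_matrix h k c"
proof -
  have k: "k = W\<^sup>2 / q ^ 6" using assms by simp
  have m: "m = c * q ^ 3" using assms by simp
  have "q ^ 6 = (q ^ 3)\<^sup>2" by (simp flip: power_mult)
  then have "(m / W)\<^sup>2 = c\<^sup>2 / k" "2 * (m / W) * (n / (W * q ^ 3)) = 2 * c * (2 * c\<^sup>2 + h) / k"
    "q ^ 3 / (2 * W) * (m / W) = c / 2 / k" "2 * (q ^ 3 / (2 * W)) * (n / (W * q ^ 3)) = (2 * c\<^sup>2 + h) / k"
    unfolding k m assms(8) using assms(4,5) by (simp_all add: field_simps power2_eq_square)
  then show ?thesis unfolding B_def residue_matrix_def assms(1-3) by simp
qed

lemma B_Phi:
  assumes q: "q ^ 4 = 1 + 2 * t" "1 + 2 * t \<noteq> 0"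
    and w: "(w$1)\<^sup>2 = 2 + t" "(w$2)\<^sup>2 = - 1 + t" "(w$3)\<^sup>2 = (1 - t) * (2 + t)"
    and t: "2 + t \<noteq> 0" "t \<noteq> 1"
  defines "c1 \<equiv> - (1 + t) / q ^ 3" and "c2 \<equiv> t / q ^ 3" and "c3 \<equiv> 1 / q ^ 3"
  defines "h \<equiv> - ((1 + t + t\<^sup>2) / q ^ 6)"
  shows "B (Phi t q w) 1 = residue_matrix h ((c1 - c2) * (c1 - c3)) c1"
    "B (Phi t q w) 2 = residue_matrix h ((c2 - c1) * (c2 - c3)) c2"
    "B (Phi t q w) 3 = residue_matrix h ((c3 - c1) * (c3 - c2)) c3"
proof -
  have q0: "q \<noteq> 0" using q by auto
  have w0: "w $ 1 \<noteq> 0" "w $ 2 \<noteq> 0" "w $ 3 \<noteq> 0" using w t by auto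
  define k where "k = 1 / q ^ 3"
  have kq: "k * q ^ 3 = 1" using q0 by (simp add: k_def)
  have c: "c1 = - (1 + t) * k" "c2 = t * k" "c3 = k" by (simp_all add: c1_def c2_def c3_def k_def)
  have h: "h = - (1 + t + t\<^sup>2) * k\<^sup>2" by (simp add: h_def k_def power_divide diff_divide_distrib add_divide_distrib flip: power_mult)
  have q6: "q ^ 6 = (q ^ 3)\<^sup>2" "(q\<^sup>2)\<^sup>2 = q ^ 4" by (simp_all flip: power_mult)
  have q5: "w $ 1 * q ^ 5 = (w $ 1 * q\<^sup>2) * q ^ 3" "w $ 2 * q ^ 5 = (w $ 2 * q\<^sup>2) * q ^ 3"
    by (simp_all flip: power_add)
  show "B (Phi t q w) 1 = residue_matrix h ((c1 - c2) * (c1 - c3)) c1"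
  proof (rule B_row)
    show "Phi t q w $ 1 $ 1 = q ^ 3 / (2 * (w $ 1 * q\<^sup>2))" "Phi t q w $ 1 $ 2 = (- 1 - t) / (w $ 1 * q\<^sup>2)"
      by (simp_all only: Phi_def vector_3)
    show "Phi t q w $ 1 $ 3 = (1 + 3 * t + t\<^sup>2) / ((w $ 1 * q\<^sup>2) * q ^ 3)"
      by (simp only: Phi_def vector_3 q5)
    show "(w $ 1 * q\<^sup>2)\<^sup>2 = (c1 - c2) * (c1 - c3) * q ^ 6"
      unfolding power_mult_distrib w q6 q(1) c using kq by algebra
    show "1 + 3 * t + t\<^sup>2 = (2 * c1\<^sup>2 + h) * q ^ 6" unfolding q6 c h using kq by algebra
  qed (use q0 w0 in \<open>simp_all add: c1_def\<close>)
  show "B (Phi t q w) 2 = residue_matrix h ((c2 - c1) * (c2 - c3)) c2"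
  proof (rule B_row)
    show "Phi t q w $ 2 $ 1 = q ^ 3 / (2 * (w $ 2 * q\<^sup>2))" "Phi t q w $ 2 $ 2 = t / (w $ 2 * q\<^sup>2)"
      by (simp_all only: Phi_def vector_3)
    show "Phi t q w $ 2 $ 3 = (- 1 - t + t\<^sup>2) / ((w $ 2 * q\<^sup>2) * q ^ 3)"
      by (simp only: Phi_def vector_3 q5)
    show "(w $ 2 * q\<^sup>2)\<^sup>2 = (c2 - c1) * (c2 - c3) * q ^ 6"
      unfolding power_mult_distrib w q6 q(1) c using kq by algebra
    show "- 1 - t + t\<^sup>2 = (2 * c2\<^sup>2 + h) * q ^ 6" unfolding q6 c h using kq by algebra
  qed (use q0 w0 in \<open>simp_all add: c2_def\<close>)
  show "B (Phi t q w) 3 = residue_matrix h ((c3 - c1) * (c3 - c2)) c3"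
  proof (rule B_row)
    show "Phi t q w $ 3 $ 1 = q ^ 3 / (2 * w $ 3)" "Phi t q w $ 3 $ 2 = 1 / w $ 3"
      "Phi t q w $ 3 $ 3 = (1 - t - t\<^sup>2) / (w $ 3 * q ^ 3)"
      by (simp_all only: Phi_def vector_3)
    show "(w $ 3)\<^sup>2 = (c3 - c1) * (c3 - c2) * q ^ 6"
      unfolding w q6 c using kq by algebra
    show "1 - t - t\<^sup>2 = (2 * c3\<^sup>2 + h) * q ^ 6" unfolding q6 c h using kq by algebra
  qed (use q0 w0 in \<open>simp_all add: c3_def\<close>)
qed

section \<open>The system satisfied by each column\<close>

text \<open>This is \<open>column_derivative\<close> with the roots read cyclically from
  \<open>i\<close>, rewritten as sums over all four roots. The third conclusion keeps the form in
  \<open>N\<close> and \<open>P\<close> for the determinant.\<close>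

lemma chi_col_derivative:
  fixes \<xi> :: "4 \<Rightarrow> complex \<Rightarrow> complex"
  assumes U: "open U" "x \<in> U" and i: "i \<in> {1, 2}"
    and hol: "\<And>i. \<xi> i holomorphic_on U" "\<sigma> holomorphic_on U" "\<rho> holomorphic_on U"
    and dist: "\<And>i j z. z \<in> U \<Longrightarrow> i \<noteq> j \<Longrightarrow> \<xi> i z \<noteq> \<xi> j z"
    and \<sigma>: "\<And>z. z \<in> U \<Longrightarrow> (\<sigma> z)\<^sup>2 = xi_diff \<xi> (i + 1) i z"
    and \<rho>: "\<And>z. z \<in> U \<Longrightarrow> \<rho> z ^ 4 = xi_diff \<xi> (i + 2) i z * xi_diff \<xi> i (i + 3) z"
    and fg: "fg_branch_on U (x_arg \<xi> i) (y_arg \<xi> i) f g"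
    and sum0: "\<And>z. z \<in> U \<Longrightarrow> \<xi> 1 z + \<xi> 2 z + \<xi> 3 z + \<xi> 4 z = 0"
    and h: "2 * h = \<xi> 1 x * \<xi> 2 x + \<xi> 1 x * \<xi> 3 x + \<xi> 1 x * \<xi> 4 x + \<xi> 2 x * \<xi> 3 x + \<xi> 2 x * \<xi> 4 x + \<xi> 3 x * \<xi> 4 x"
    and D: "\<And>i. (\<xi> i has_field_derivative D i) (at x)" "\<And>i. (\<Prod>j\<in>UNIV - {i}. \<xi> i x - \<xi> j x) * D i = 1"
  defines "X \<equiv> chi_col \<xi> i \<sigma> \<rho> f g"
  shows "((\<lambda>z. X z $ 1) has_field_derivative
      - ((\<Sum>i\<in>UNIV. (\<xi> i x)\<^sup>2 * (D i)\<^sup>2) * X x $ 1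
        + (\<Sum>i\<in>UNIV. 2 * \<xi> i x * (2 * (\<xi> i x)\<^sup>2 + h) * (D i)\<^sup>2) * X x $ 2)) (at x)"
    "((\<lambda>z. X z $ 2) has_field_derivative
      - ((\<Sum>i\<in>UNIV. \<xi> i x / 2 * (D i)\<^sup>2) * X x $ 1
        + (\<Sum>i\<in>UNIV. (2 * (\<xi> i x)\<^sup>2 + h) * (D i)\<^sup>2) * X x $ 2)) (at x)"
    "\<exists>N P. N \<noteq> 0 \<and> X x $ 1 = N * (\<xi> (i + 1) x + \<xi> i x * P) \<and> X x $ 2 = N * ((1 + P) / 2) \<and>
      P\<^sup>2 * ((\<xi> (i + 2) x - \<xi> i x) * (\<xi> (i + 3) x - \<xi> i x))
        = (\<xi> (i + 2) x - \<xi> (i + 1) x) * (\<xi> (i + 3) x - \<xi> (i + 1) x)"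
proof -
  define a where "a = \<xi> i"
  define b where "b = \<xi> (i + 1)"
  define c where "c = \<xi> (i + 2)"
  define d where "d = \<xi> (i + 3)"
  have idx: "i \<noteq> i + 1" "i \<noteq> i + 2" "i \<noteq> i + 3" "i + 1 \<noteq> i + 2" "i + 1 \<noteq> i + 3" "i + 2 \<noteq> i + 3"
    by simp_all
  have ne: "a z \<noteq> b z" "a z \<noteq> c z" "a z \<noteq> d z" "b z \<noteq> c z" "b z \<noteq> d z" "c z \<noteq> d z" if "z \<in> U" for z
    using dist[OF that] idx unfolding a_def b_def c_def d_def by simp_all
  have "(1 :: 4) + 1 = 2" "(1 :: 4) + 2 = 3" "(1 :: 4) + 3 = 4" "(2 :: 4) + 1 = 3" "(2 :: 4) + 2 = 4" "(2 :: 4) + 3 = 1"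
    by simp_all
  \<comment> \<open>The two cases turn the cyclic indices into explicit ones, so that symmetric
    expressions in all roots can be reordered.\<close>
  then consider (1) "i = 1" "i + 1 = 2" "i + 2 = 3" "i + 3 = 4" | (2) "i = 2" "i + 1 = 3" "i + 2 = 4" "i + 3 = 1"
    using i by blast
  note i_cases = this
  have UNIV4: "(\<Sum>j\<in>UNIV. F j) = F i + F (i + 1) + F (i + 2) + F (i + 3)" for F :: "4 \<Rightarrow> complex"
    by (cases rule: i_cases) (simp_all only: sum_4 add_ac)
  have fd: "F field_differentiable at z" if "F holomorphic_on U" "z \<in> U" for F z
    using that U(1) by (auto simp: holomorphic_on_open field_differentiable_def)
  have xi_fd: "\<xi> j field_differentiable at z" if "z \<in> U" for j z by (rule fd[OF hol(1) that])
  have x_arg: "x_arg \<xi> i = (\<lambda>z. (b z - a z) / (c z - a z))" and y_arg: "y_arg \<xi> i = (\<lambda>z. (b z - a z) / (d z - a z))"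
    by (simp_all add: x_arg_def y_arg_def xi_diff_def a_def b_def c_def d_def fun_eq_iff)
  have args_fd: "x_arg \<xi> i field_differentiable at z" "y_arg \<xi> i field_differentiable at z" if "z \<in> U" for z
    unfolding x_arg y_arg using ne[OF that] xi_fd[OF that]
    by (auto intro!: derivative_intros simp: a_def b_def c_def d_def)
  note fg' = fg_branch_on_relations[OF fg _ args_fd]
  define P where "P = (\<lambda>z. (2 * g z - f z) / f z)"
  define N where "N = (\<lambda>z. f z / (\<sigma> z * \<rho> z ^ 3))"
  have rels: "f z \<noteq> 0" "\<sigma> z \<noteq> 0" "\<rho> z \<noteq> 0" "P z ^ 2 * ((c z - a z) * (d z - a z)) = (c z - b z) * (d z - b z)"
    "N z ^ 4 * (((c z - b z) * (d z - b z)) ^ 2 *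
        ((c z - b z) * (d z - a z) + (d z - b z) * (c z - a z) + 2 * (P z * ((c z - a z) * (d z - a z))))
        * (b z - a z) ^ 2) = - 4"
    "1 / (\<sigma> z * \<rho> z ^ 3) * ((b z - a z) * f z + 2 * a z * g z) = N z * (b z + a z * P z)"
    "1 / (\<sigma> z * \<rho> z ^ 3) * g z = N z * ((1 + P z) / 2)" if "z \<in> U" for z
  proof -
    have s: "(\<sigma> z)\<^sup>2 = b z - a z" "\<rho> z ^ 4 = (c z - a z) * (a z - d z)"
      using \<sigma>[OF that] \<rho>[OF that] by (simp_all add: xi_diff_def a_def b_def c_def d_def)
    have "x_arg \<xi> i z = (b z - a z) / (c z - a z)" "y_arg \<xi> i z = (b z - a z) / (d z - a z)"
      by (simp_all add: x_arg y_arg)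
    note r = period_relations[OF ne(1-5)[OF that] this s fg'(3,4)[OF that that that]]
    show "f z \<noteq> 0" "\<sigma> z \<noteq> 0" "\<rho> z \<noteq> 0" "P z ^ 2 * ((c z - a z) * (d z - a z)) = (c z - b z) * (d z - b z)"
    "N z ^ 4 * (((c z - b z) * (d z - b z)) ^ 2 *
        ((c z - b z) * (d z - a z) + (d z - b z) * (c z - a z) + 2 * (P z * ((c z - a z) * (d z - a z))))
        * (b z - a z) ^ 2) = - 4"
    "1 / (\<sigma> z * \<rho> z ^ 3) * ((b z - a z) * f z + 2 * a z * g z) = N z * (b z + a z * P z)"
    "1 / (\<sigma> z * \<rho> z ^ 3) * g z = N z * ((1 + P z) / 2)"
      unfolding P_def N_def by (fact r)+
  qed
  have X: "X z $ 1 = N z * (b z + a z * P z)" "X z $ 2 = N z * ((1 + P z) / 2)" if "z \<in> U" for z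
    using rels(6,7)[OF that] by (simp_all add: X_def chi_col_def xi_diff_def a_def b_def)
  have fgd: "f field_differentiable at x" "g field_differentiable at x"
    using fg'(1,2)[OF U(2) U(2) U(2)] by auto
  have Nd: "N field_differentiable at x" unfolding N_def
    using rels(1-3)[OF U(2)] fgd fd[OF hol(2) U(2)] fd[OF hol(3) U(2)] by (intro derivative_intros) auto
  have Pd: "P field_differentiable at x" unfolding P_def
    using rels(1)[OF U(2)] fgd by (intro derivative_intros) auto
  have sum: "a z + b z + c z + d z = 0" if "z \<in> U" for z
    using sum0[OF that] UNIV4[of "\<lambda>j. \<xi> j z"] by (simp add: sum_4 a_def b_def c_def d_def)
  have h': "2 * h = a x * b x + a x * c x + a x * d x + b x * c x + b x * d x + c x * d x"
  proof (cases rule: i_cases)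
    case 1
    show ?thesis unfolding a_def b_def c_def d_def 1(2-4) unfolding 1(1) by (rule h)
  next
    case 2
    show ?thesis unfolding a_def b_def c_def d_def 2(2-4) unfolding 2(1) using h by (simp only: mult_ac add_ac)
  qed
  have inv: "(a x - b x) * (a x - c x) * (a x - d x) * D i = 1"
      "(b x - a x) * (b x - c x) * (b x - d x) * D (i + 1) = 1"
      "(c x - a x) * (c x - b x) * (c x - d x) * D (i + 2) = 1"
      "(d x - a x) * (d x - b x) * (d x - c x) * D (i + 3) = 1"
  proof -
    have others: "UNIV - {1 :: 4} = {2, 3, 4}" "UNIV - {2 :: 4} = {1, 3, 4}" "UNIV - {3 :: 4} = {1, 2, 4}"
      "UNIV - {4 :: 4} = {1, 2, 3}" unfolding UNIV_4 by (simp_all add: insert_Diff_if)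
    have prods: "prod F {2, 3, 4} = F 2 * F 3 * F 4" "prod F {1, 3, 4} = F 1 * F 3 * F 4"
      "prod F {1, 2, 4} = F 1 * F 2 * F 4" "prod F {1, 2, 3} = F 1 * F 2 * F 3" for F :: "4 \<Rightarrow> complex"
      by (simp_all add: mult.assoc)
    note D4 = D(2)[of 1, unfolded others prods] D(2)[of 2, unfolded others prods]
      D(2)[of 3, unfolded others prods] D(2)[of 4, unfolded others prods]
    have "(a x - b x) * (a x - c x) * (a x - d x) * D i = 1 \<and>
      (b x - a x) * (b x - c x) * (b x - d x) * D (i + 1) = 1 \<and>
      (c x - a x) * (c x - b x) * (c x - d x) * D (i + 2) = 1 \<and>
      (d x - a x) * (d x - b x) * (d x - c x) * D (i + 3) = 1"
    proof (cases rule: i_cases)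
      case 1
      show ?thesis unfolding a_def b_def c_def d_def 1(2-4) unfolding 1(1) using D4 by simp
    next
      case 2
      show ?thesis unfolding a_def b_def c_def d_def 2(2-4) unfolding 2(1) using D4
        by (simp only: mult_ac simp_thms)
    qed
    then show "(a x - b x) * (a x - c x) * (a x - d x) * D i = 1"
      "(b x - a x) * (b x - c x) * (b x - d x) * D (i + 1) = 1"
      "(c x - a x) * (c x - b x) * (c x - d x) * D (i + 2) = 1"
      "(d x - a x) * (d x - b x) * (d x - c x) * D (i + 3) = 1" by blast+
  qed
  note main = column_derivative[OF U D(1)[of i, folded a_def] D(1)[of "i + 1", folded b_def] D(1)[of "i + 2", folded c_def]
      D(1)[of "i + 3", folded d_def] Nd Pd ne[OF U(2)] rels(4,5) sum h' inv]
  have "((\<lambda>z. X z $ 1) has_field_derivative D') (at x) \<longleftrightarrow> ((\<lambda>z. N z * (b z + a z * P z)) has_field_derivative D') (at x)"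
    "((\<lambda>z. X z $ 2) has_field_derivative D') (at x) \<longleftrightarrow> ((\<lambda>z. N z * ((1 + P z) / 2)) has_field_derivative D') (at x)" for D'
    by (intro DERIV_cong_ev refl eventually_mono[OF eventually_nhds_in_open[OF U]]; simp add: X)+
  then show "((\<lambda>z. X z $ 1) has_field_derivative
      - ((\<Sum>i\<in>UNIV. (\<xi> i x)\<^sup>2 * (D i)\<^sup>2) * X x $ 1
        + (\<Sum>i\<in>UNIV. 2 * \<xi> i x * (2 * (\<xi> i x)\<^sup>2 + h) * (D i)\<^sup>2) * X x $ 2)) (at x)"
    "((\<lambda>z. X z $ 2) has_field_derivative
      - ((\<Sum>i\<in>UNIV. \<xi> i x / 2 * (D i)\<^sup>2) * X x $ 1
        + (\<Sum>i\<in>UNIV. (2 * (\<xi> i x)\<^sup>2 + h) * (D i)\<^sup>2) * X x $ 2)) (at x)"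
    using main unfolding UNIV4 X[OF U(2)] a_def[symmetric] b_def[symmetric] c_def[symmetric] d_def[symmetric]
    by (simp_all only: add_divide_distrib times_divide_eq_left)
  have "N x \<noteq> 0" using rels(1-3)[OF U(2)] by (simp add: N_def)
  then show "\<exists>N P. N \<noteq> 0 \<and> X x $ 1 = N * (\<xi> (i + 1) x + \<xi> i x * P) \<and> X x $ 2 = N * ((1 + P) / 2) \<and>
      P\<^sup>2 * ((\<xi> (i + 2) x - \<xi> i x) * (\<xi> (i + 3) x - \<xi> i x))
        = (\<xi> (i + 2) x - \<xi> (i + 1) x) * (\<xi> (i + 3) x - \<xi> (i + 1) x)"
    using X[OF U(2)] rels(4)[OF U(2)] unfolding a_def b_def c_def d_def by blast
qed

text \<open>Each entry is \<open>critical_point_sum\<close> for a polynomial of degree at most 3,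
  below the number of roots; the factor 4 obtained there is turned into - 1 by \<mu> = -
  1/4.\<close>

lemma fuchs_matrix_entries:
  fixes \<xi> :: "4 \<Rightarrow> complex"
  assumes s: "1 + 2 * t \<noteq> 0" "s = t * (2 + t) ^ 3 / (1 + 2 * t) ^ 3" "s \<noteq> 0" "s \<noteq> 1"
    and q: "q ^ 4 = 1 + 2 * t"
    and w: "(w$1)\<^sup>2 = 2 + t" "(w$2)\<^sup>2 = - 1 + t" "(w$3)\<^sup>2 = (1 - t) * (2 + t)"
    and \<epsilon>: "\<epsilon> \<noteq> 0" "\<epsilon> \<noteq> 1" "\<epsilon> \<noteq> s"
    and roots: "lambda_bar t q \<epsilon> = (\<Prod>i\<in>UNIV. [:- \<xi> i, 1:])"
    and D: "\<And>i. (\<Prod>j\<in>UNIV - {i}. \<xi> i - \<xi> j) * D i = 1"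
    and D': "\<And>i. 4 * ((\<xi> i + (1 + t) / q ^ 3) * (\<xi> i - t / q ^ 3) * (\<xi> i - 1 / q ^ 3)) * D i = 1"
    and inj: "inj \<xi>"
  defines "h \<equiv> - ((1 + t + t\<^sup>2) / q ^ 6)" and "A \<equiv> fuchs_matrix (Phi t q w) s \<epsilon>"
  shows "A $ 1 $ 1 = - (\<Sum>i\<in>UNIV. (\<xi> i)\<^sup>2 * (D i)\<^sup>2)"
    "A $ 1 $ 2 = - (\<Sum>i\<in>UNIV. 2 * \<xi> i * (2 * (\<xi> i)\<^sup>2 + h) * (D i)\<^sup>2)"
    "A $ 2 $ 1 = - (\<Sum>i\<in>UNIV. \<xi> i / 2 * (D i)\<^sup>2)"
    "A $ 2 $ 2 = - (\<Sum>i\<in>UNIV. (2 * (\<xi> i)\<^sup>2 + h) * (D i)\<^sup>2)"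
proof -
  define c1 where "c1 = - (1 + t) / q ^ 3"
  define c2 where "c2 = t / q ^ 3"
  define c3 where "c3 = 1 / q ^ 3"
  have q0: "q \<noteq> 0" using q s by auto
  \<comment> \<open>Up to sign and the factor 1 / q^3, the differences of the critical points are 1
    + 2 t, 2 + t and t - 1. Hence s \<noteq> 0 and s \<noteq> 1 help to keep these points
    distinct.\<close>
  have "2 + t \<noteq> 0" using s(2,3) by auto
  have "t \<noteq> 1" using s(2,4) by auto
  have q3: "q ^ 3 \<noteq> 0" using q0 by simp
  have diffs: "c1 - c2 = - (1 + 2 * t) / q ^ 3" "c1 - c3 = - (2 + t) / q ^ 3" "c2 - c3 = (t - 1) / q ^ 3"
    by (simp_all add: c1_def c2_def c3_def diff_divide_distrib add_divide_distrib)
  have "c1 - c2 \<noteq> 0" "c1 - c3 \<noteq> 0" "c2 - c3 \<noteq> 0"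
    unfolding diffs divide_eq_0_iff neg_equal_0_iff_equal using s(1) \<open>2 + t \<noteq> 0\<close> \<open>t \<noteq> 1\<close> q3 by simp_all
  then have cne: "c1 \<noteq> c2" "c1 \<noteq> c3" "c2 \<noteq> c3" by auto
  note crit = lambda_bar_critical_points[OF q s(1), folded c1_def c2_def c3_def]
  have L: "poly (lambda_bar t q \<epsilon>) z = (\<Prod>i\<in>UNIV. z - \<xi> i)" for z
    by (simp add: roots poly_prod)
  \<comment> \<open>The quartic at a critical point is the critical value minus \<epsilon>: this
    produces the denominators of the system and separates critical points from roots.\<close>
  have prods: "(\<Prod>i\<in>UNIV. c1 - \<xi> i) = - \<epsilon>" "(\<Prod>i\<in>UNIV. c2 - \<xi> i) = 1 - \<epsilon>" "(\<Prod>i\<in>UNIV. c3 - \<xi> i) = s - \<epsilon>"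
    using crit(4-6)[of \<epsilon>] unfolding L s(2)[symmetric] by simp_all
  have xne: "c1 \<noteq> \<xi> i" "c2 \<noteq> \<xi> i" "c3 \<noteq> \<xi> i" for i
  proof -
    have "c \<noteq> \<xi> i" if nz: "(\<Prod>j\<in>UNIV. c - \<xi> j) \<noteq> 0" for c
    proof
      assume "c = \<xi> i"
      then have "(\<Prod>j\<in>UNIV. c - \<xi> j) = 0" by (intro prod_zero bexI[of _ i]) simp_all
      with nz show False ..
    qed
    from this[of c1] this[of c2] this[of c3] show "c1 \<noteq> \<xi> i" "c2 \<noteq> \<xi> i" "c3 \<noteq> \<xi> i"
      unfolding prods using \<epsilon> by auto
  qed
  have D'': "4 * ((\<xi> i - c1) * (\<xi> i - c2) * (\<xi> i - c3)) * D i = 1" for i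
    using D'[of i] by (simp add: c1_def c2_def c3_def minus_divide_left[symmetric] del: minus_add_distrib)
  have key: "poly p c1 / ((c1 - c2) * (c1 - c3)) / \<epsilon> + poly p c2 / ((c2 - c1) * (c2 - c3)) / (\<epsilon> - 1)
      + poly p c3 / ((c3 - c1) * (c3 - c2)) / (\<epsilon> - s) = 4 * (\<Sum>i\<in>UNIV. poly p (\<xi> i) * (D i)\<^sup>2)"
    if "degree p < 4" for p
  proof -
    have m: "k / (- \<epsilon>) = - (k / \<epsilon>)" "k / (1 - \<epsilon>) = - (k / (\<epsilon> - 1))" "k / (s - \<epsilon>) = - (k / (\<epsilon> - s))" for k
      by (metis minus_diff_eq divide_minus_right)+
    have "- (poly p c1 / ((c1 - c2) * (c1 - c3)) / \<epsilon>) + - (poly p c2 / ((c2 - c1) * (c2 - c3)) / (\<epsilon> - 1))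
      + - (poly p c3 / ((c3 - c1) * (c3 - c2)) / (\<epsilon> - s)) = - 4 * (\<Sum>i\<in>UNIV. poly p (\<xi> i) * (D i)\<^sup>2)"
      using critical_point_sum[of UNIV \<xi> p c1 c2 c3 D, OF _ inj _ cne xne D D''] that
      unfolding prods m by simp
    then show ?thesis by (simp add: algebra_simps)
  qed
  have deg: "degree [:0, 0, 1 :: complex:] < 4" "degree [:0, 2 * h, 0, 4:] < 4" "degree [:0, 1 / 2 :: complex:] < 4"
    "degree [:h, 0, 2:] < 4"
    by (simp_all add: numeral_eq_Suc)
  have polys: "poly [:0, 0, 1:] z = z\<^sup>2" "poly [:0, 2 * h, 0, 4:] z = 2 * z * (2 * z\<^sup>2 + h)" "poly [:0, 1 / 2:] z = z / 2"
    "poly [:h, 0, 2:] z = 2 * z\<^sup>2 + h" for z :: complex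
    by (simp_all add: power2_eq_square algebra_simps)
  note BP = B_Phi[OF q s(1) w \<open>2 + t \<noteq> 0\<close> \<open>t \<noteq> 1\<close>, folded c1_def c2_def c3_def h_def]
  have A: "A $ j $ k = residue_matrix h ((c1 - c2) * (c1 - c3)) c1 $ j $ k / \<epsilon>
     + residue_matrix h ((c2 - c1) * (c2 - c3)) c2 $ j $ k / (\<epsilon> - 1)
     + residue_matrix h ((c3 - c1) * (c3 - c2)) c3 $ j $ k / (\<epsilon> - s)" for j k
    by (simp add: A_def fuchs_matrix_def BP)
  have fac: "\<mu> * u / \<epsilon> + \<mu> * v / (\<epsilon> - 1) + \<mu> * z / (\<epsilon> - s) = - (u / \<epsilon> + v / (\<epsilon> - 1) + z / (\<epsilon> - s)) / 4" for u v z
  proof -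
    have "\<mu> * k + \<mu> * l + \<mu> * m = - (k + l + m) / 4" for k l m by (simp add: \<mu>_def field_simps)
    from this[of "u / \<epsilon>" "v / (\<epsilon> - 1)" "z / (\<epsilon> - s)"] show ?thesis by (simp only: times_divide_eq_right)
  qed
  show "A $ 1 $ 1 = - (\<Sum>i\<in>UNIV. (\<xi> i)\<^sup>2 * (D i)\<^sup>2)"
    using key[OF deg(1)] unfolding A residue_matrix_def vector_2 fac polys by simp
  show "A $ 1 $ 2 = - (\<Sum>i\<in>UNIV. 2 * \<xi> i * (2 * (\<xi> i)\<^sup>2 + h) * (D i)\<^sup>2)"
    using key[OF deg(2)] unfolding A residue_matrix_def vector_2 fac polys by simp
  show "A $ 2 $ 1 = - (\<Sum>i\<in>UNIV. \<xi> i / 2 * (D i)\<^sup>2)"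
    using key[OF deg(3)] unfolding A residue_matrix_def vector_2 fac polys by simp
  show "A $ 2 $ 2 = - (\<Sum>i\<in>UNIV. (2 * (\<xi> i)\<^sup>2 + h) * (D i)\<^sup>2)"
    using key[OF deg(4)] unfolding A residue_matrix_def vector_2 fac polys by simp
qed

text \<open>Differentiating the equation of a root gives \<lambda>'(\<xi>) \<xi>' = 1. Factoring
  \<lambda>' over the critical points, or evaluating it as a product over the other roots, gives the
  two forms. A repeated root would make the second product zero, so the roots are distinct.\<close>

lemma root_derivative:
  fixes \<xi> :: "4 \<Rightarrow> complex \<Rightarrow> complex"
  assumes q: "q ^ 4 = 1 + 2 * t" "1 + 2 * t \<noteq> 0"
    and U: "open U" "x \<in> U" and hol: "\<And>i. \<xi> i holomorphic_on U"
    and roots: "\<And>\<epsilon>. \<epsilon> \<in> U \<Longrightarrow> lambda_bar t q \<epsilon> = (\<Prod>i\<in>UNIV. [:- \<xi> i \<epsilon>, 1:])"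
  shows "(\<xi> i has_field_derivative deriv (\<xi> i) x) (at x)"
    "4 * ((\<xi> i x + (1 + t) / q ^ 3) * (\<xi> i x - t / q ^ 3) * (\<xi> i x - 1 / q ^ 3)) * deriv (\<xi> i) x = 1"
    "(\<Prod>j\<in>UNIV - {i}. \<xi> i x - \<xi> j x) * deriv (\<xi> i) x = 1"
    "inj (\<lambda>i. \<xi> i x)"
proof -
  have D: "(\<xi> i has_field_derivative deriv (\<xi> i) x) (at x)" for i
    by (rule holomorphic_derivI[OF hol U])
  then show "(\<xi> i has_field_derivative deriv (\<xi> i) x) (at x)" .
  note c = lambda_bar_critical_points(1-3)[OF q]
  have lam: "poly (pderiv (lambda_bar t q z)) y
      = 4 * ((y + (1 + t) / q ^ 3) * (y - t / q ^ 3) * (y - 1 / q ^ 3))" for y z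
  proof -
    define c1 c2 c3 where "c1 = - (1 + t) / q ^ 3" and "c2 = t / q ^ 3" and "c3 = 1 / q ^ 3"
    note c = c[folded c1_def c2_def c3_def]
    have "poly (pderiv (lambda_bar t q z)) y = 4 * y ^ 3 + 4 * (c1 * c2 + c1 * c3 + c2 * c3) * y - 4 * (c1 * c2 * c3)"
    proof -
      define m n where "m = t * (1 + t) / q ^ 9" and "n = (1 + t + t\<^sup>2) / q ^ 6"
      show ?thesis unfolding c lambda_bar_def m_def[symmetric] n_def[symmetric]
        by (simp add: pderiv_pCons algebra_simps power3_eq_cube)
    qed
    also have "\<dots> = 4 * ((y - c1) * (y - c2) * (y - c3))" using c(1) by algebra
    finally show ?thesis by (simp add: c1_def c2_def c3_def minus_divide_left[symmetric] del: minus_add_distrib)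
  qed
  have D': "poly (pderiv (lambda_bar t q x)) (\<xi> i x) * deriv (\<xi> i) x = 1" for i
  proof -
    \<comment> \<open>The parameter enters only the constant coefficient, so each root inverts the
      fixed polynomial \<open>lambda_bar t q 0\<close>.\<close>
    have "lambda_bar t q z = lambda_bar t q 0 - [:z:]" for z by (simp add: lambda_bar_def)
    then have shift: "poly (lambda_bar t q z) y = poly (lambda_bar t q 0) y - z"
      "pderiv (lambda_bar t q z) = pderiv (lambda_bar t q 0)" for z y
      by (metis poly_diff poly_pCons poly_0 mult_zero_right add_0_right)
        (metis \<open>\<And>z. lambda_bar t q z = lambda_bar t q 0 - [:z:]\<close> pderiv_diff pderiv_singleton diff_zero)
    have "((\<lambda>z. poly (lambda_bar t q 0) (\<xi> i z)) has_field_derivative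
        poly (pderiv (lambda_bar t q 0)) (\<xi> i x) * deriv (\<xi> i) x) (at x)"
      by (rule DERIV_chain2[OF poly_DERIV D])
    moreover have "poly (lambda_bar t q 0) (\<xi> i z) = z" if "z \<in> U" for z
    proof -
      have "poly (lambda_bar t q z) (\<xi> i z) = 0"
        unfolding roots[OF that] poly_prod by (intro prod_zero bexI[of _ i]) simp_all
      then show ?thesis by (simp add: shift(1)[of z])
    qed
    ultimately have "((\<lambda>z. z) has_field_derivative poly (pderiv (lambda_bar t q 0)) (\<xi> i x) * deriv (\<xi> i) x) (at x)"
      by (rule has_field_derivative_transform_within_open[OF _ U])
    from DERIV_unique[OF this DERIV_ident] show ?thesis by (simp add: shift(2)[of x])
  qed
  show "4 * ((\<xi> i x + (1 + t) / q ^ 3) * (\<xi> i x - t / q ^ 3) * (\<xi> i x - 1 / q ^ 3)) * deriv (\<xi> i) x = 1"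
    using D'[of i] unfolding lam .
  have pd: "poly (pderiv (lambda_bar t q x)) (\<xi> i x) = (\<Prod>j\<in>UNIV - {i}. \<xi> i x - \<xi> j x)" for i
  proof -
    define r where "r = (\<Prod>j\<in>UNIV - {i}. [:- \<xi> j x, 1:])"
    have "lambda_bar t q x = [:- \<xi> i x, 1:] * r"
      unfolding roots[OF U(2)] r_def by (rule prod.remove) simp_all
    then have "poly (pderiv (lambda_bar t q x)) (\<xi> i x) = poly r (\<xi> i x)"
      by (simp only: pderiv_mult pderiv_pCons poly_add poly_mult) simp
    then show ?thesis by (simp add: r_def poly_prod)
  qed
  show D'': "(\<Prod>j\<in>UNIV - {i}. \<xi> i x - \<xi> j x) * deriv (\<xi> i) x = 1" for i
    using D'[of i] unfolding pd .
  show "inj (\<lambda>i. \<xi> i x)"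
  proof (rule injI, rule ccontr)
    fix i j assume "\<xi> i x = \<xi> j x" "i \<noteq> j"
    then have *: "(\<Prod>k\<in>UNIV - {i}. \<xi> i x - \<xi> k x) = 0" by (intro prod_zero bexI[of _ j]) simp_all
    show False using D''[of i] unfolding * by simp
  qed
qed

section \<open>The fundamental solution\<close>

theorem proposition5:
  fixes s t q :: complex and w :: "complex^3" and U :: "complex set"
    and \<xi> :: "4 \<Rightarrow> complex \<Rightarrow> complex"
    and \<sigma> \<rho> f g :: "4 \<Rightarrow> complex \<Rightarrow> complex"
  assumes s: "1 + 2 * t \<noteq> 0" "s = t * (2 + t) ^ 3 / (1 + 2 * t) ^ 3" "s \<noteq> 0" "s \<noteq> 1"
    and q: "q ^ 4 = 1 + 2 * t"
    and w: "(w$1)\<^sup>2 = 2 + t" "(w$2)\<^sup>2 = - 1 + t" "(w$3)\<^sup>2 = (1 - t) * (2 + t)"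
    and U: "open U" "connected U" "U \<noteq> {}" "0 \<notin> U" "1 \<notin> U" "s \<notin> U"
    and \<xi>_hol: "\<And>i. \<xi> i holomorphic_on U"
    and \<xi>_roots: "\<And>\<epsilon>. \<epsilon> \<in> U \<Longrightarrow> lambda_bar t q \<epsilon> = (\<Prod>i\<in>UNIV. [:- \<xi> i \<epsilon>, 1:])"
    and \<sigma>: "\<And>i. i \<in> {1, 2} \<Longrightarrow> \<sigma> i holomorphic_on U"
      "\<And>i \<epsilon>. i \<in> {1, 2} \<Longrightarrow> \<epsilon> \<in> U \<Longrightarrow> (\<sigma> i \<epsilon>)\<^sup>2 = xi_diff \<xi> (i + 1) i \<epsilon>"
    and \<rho>: "\<And>i. i \<in> {1, 2} \<Longrightarrow> \<rho> i holomorphic_on U"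
      "\<And>i \<epsilon>. i \<in> {1, 2} \<Longrightarrow> \<epsilon> \<in> U \<Longrightarrow>
        \<rho> i \<epsilon> ^ 4 = xi_diff \<xi> (i + 2) i \<epsilon> * xi_diff \<xi> i (i + 3) \<epsilon>"
    and fg: "\<And>i. i \<in> {1, 2} \<Longrightarrow> fg_branch_on U (x_arg \<xi> i) (y_arg \<xi> i) (f i) (g i)"
  shows "fundamental_solution U (fuchs_matrix (Phi t q w) s)
    (\<lambda>\<epsilon>. transpose (vector [chi_col \<xi> 1 (\<sigma> 1) (\<rho> 1) (f 1) (g 1) \<epsilon>,
                            chi_col \<xi> 2 (\<sigma> 2) (\<rho> 2) (f 2) (g 2) \<epsilon>]))"
  unfolding fundamental_solution_def
proof (intro ballI conjI)
  fix \<epsilon> assume \<epsilon>: "\<epsilon> \<in> U"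
  \<comment> \<open>Half the second elementary symmetric function of the roots, independent of
    \<epsilon>.\<close>
  define h where "h = - ((1 + t + t\<^sup>2) / q ^ 6)"
  define D where "D i = deriv (\<xi> i) \<epsilon>" for i
  define X where "X i = chi_col \<xi> i (\<sigma> i) (\<rho> i) (f i) (g i)" for i
  define A where "A = fuchs_matrix (Phi t q w) s \<epsilon>"
  note root = root_derivative[OF q s(1) U(1) _ \<xi>_hol \<xi>_roots]
  have factors: "lambda_bar t q z = [:- \<xi> 1 z, 1:] * [:- \<xi> 2 z, 1:] * [:- \<xi> 3 z, 1:] * [:- \<xi> 4 z, 1:]"
    if "z \<in> U" for z
    unfolding \<xi>_roots[OF that] UNIV_4 by (simp add: mult.assoc del: mult_pCons_left mult_pCons_right)
  note coeffs = lambda_bar_coeffs[OF factors]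
  have h2: "2 * h = \<xi> 1 \<epsilon> * \<xi> 2 \<epsilon> + \<xi> 1 \<epsilon> * \<xi> 3 \<epsilon> + \<xi> 1 \<epsilon> * \<xi> 4 \<epsilon> + \<xi> 2 \<epsilon> * \<xi> 3 \<epsilon> + \<xi> 2 \<epsilon> * \<xi> 4 \<epsilon> + \<xi> 3 \<epsilon> * \<xi> 4 \<epsilon>"
    unfolding coeffs(2)[OF \<epsilon>] h_def by (simp only: mult_minus_right mult_minus_left)
  have dist: "\<xi> i z \<noteq> \<xi> j z" if "z \<in> U" "i \<noteq> j" for i j z
    using root(4)[OF that(1)] that(2) by (auto dest: injD)
  have col: "((\<lambda>z. X i z $ 1) has_field_derivative A $ 1 $ 1 * X i \<epsilon> $ 1 + A $ 1 $ 2 * X i \<epsilon> $ 2) (at \<epsilon>)"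
    "((\<lambda>z. X i z $ 2) has_field_derivative A $ 2 $ 1 * X i \<epsilon> $ 1 + A $ 2 $ 2 * X i \<epsilon> $ 2) (at \<epsilon>)"
    "\<exists>N P. N \<noteq> 0 \<and> X i \<epsilon> $ 1 = N * (\<xi> (i + 1) \<epsilon> + \<xi> i \<epsilon> * P) \<and> X i \<epsilon> $ 2 = N * ((1 + P) / 2) \<and>
      P\<^sup>2 * ((\<xi> (i + 2) \<epsilon> - \<xi> i \<epsilon>) * (\<xi> (i + 3) \<epsilon> - \<xi> i \<epsilon>))
        = (\<xi> (i + 2) \<epsilon> - \<xi> (i + 1) \<epsilon>) * (\<xi> (i + 3) \<epsilon> - \<xi> (i + 1) \<epsilon>)"
    if i: "i \<in> {1, 2}" for i
  proof -
    have "\<epsilon> \<noteq> 0" "\<epsilon> \<noteq> 1" "\<epsilon> \<noteq> s" using \<epsilon> U by auto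
    note A = fuchs_matrix_entries[OF s q w this \<xi>_roots[OF \<epsilon>] root(3)[OF \<epsilon>] root(2)[OF \<epsilon>] root(4)[OF \<epsilon>],
        folded A_def h_def D_def]
    note chi = chi_col_derivative[OF U(1) \<epsilon> i \<xi>_hol \<sigma>(1)[OF i] \<rho>(1)[OF i] dist \<sigma>(2)[OF i] \<rho>(2)[OF i] fg[OF i]
        coeffs(1) h2 root(1)[OF \<epsilon>] root(3)[OF \<epsilon>], folded X_def D_def]
    show "((\<lambda>z. X i z $ 1) has_field_derivative A $ 1 $ 1 * X i \<epsilon> $ 1 + A $ 1 $ 2 * X i \<epsilon> $ 2) (at \<epsilon>)"
      by (rule DERIV_cong, rule chi(1)) (simp_all only: A minus_add_distrib mult_minus_left simp_thms)
    show "((\<lambda>z. X i z $ 2) has_field_derivative A $ 2 $ 1 * X i \<epsilon> $ 1 + A $ 2 $ 2 * X i \<epsilon> $ 2) (at \<epsilon>)"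
      by (rule DERIV_cong, rule chi(2)) (simp_all only: A minus_add_distrib mult_minus_left simp_thms)
    show "\<exists>N P. N \<noteq> 0 \<and> X i \<epsilon> $ 1 = N * (\<xi> (i + 1) \<epsilon> + \<xi> i \<epsilon> * P) \<and> X i \<epsilon> $ 2 = N * ((1 + P) / 2) \<and>
      P\<^sup>2 * ((\<xi> (i + 2) \<epsilon> - \<xi> i \<epsilon>) * (\<xi> (i + 3) \<epsilon> - \<xi> i \<epsilon>))
        = (\<xi> (i + 2) \<epsilon> - \<xi> (i + 1) \<epsilon>) * (\<xi> (i + 3) \<epsilon> - \<xi> (i + 1) \<epsilon>)"
      by (rule chi(3))
  qed
  note A_def' = A_def[symmetric]
  have X_def': "chi_col \<xi> 1 (\<sigma> 1) (\<rho> 1) (f 1) (g 1) = X 1" "chi_col \<xi> 2 (\<sigma> 2) (\<rho> 2) (f 2) (g 2) = X 2"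
    by (simp_all add: X_def)
  show "\<forall>j k. ((\<lambda>e. transpose (vector [chi_col \<xi> 1 (\<sigma> 1) (\<rho> 1) (f 1) (g 1) e,
      chi_col \<xi> 2 (\<sigma> 2) (\<rho> 2) (f 2) (g 2) e] :: complex^2^2) $ j $ k) has_field_derivative
      (fuchs_matrix (Phi t q w) s \<epsilon> ** transpose (vector [chi_col \<xi> 1 (\<sigma> 1) (\<rho> 1) (f 1) (g 1) \<epsilon>,
        chi_col \<xi> 2 (\<sigma> 2) (\<rho> 2) (f 2) (g 2) \<epsilon>])) $ j $ k) (at \<epsilon>)"
    unfolding A_def' X_def' using col(1,2)
    by (simp add: forall_2 transpose_def matrix_matrix_mult_def sum_2 vector_2)
  have idx: "(1 :: 4) + 1 = 2" "(1 :: 4) + 2 = 3" "(1 :: 4) + 3 = 4" "(2 :: 4) + 1 = 3" "(2 :: 4) + 2 = 4" "(2 :: 4) + 3 = 1"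
    by simp_all
  \<comment> \<open>Column 1 belongs to the pairing of roots 1, 2 and 3, 4; column 2 to that of 2, 3
    and 4, 1.\<close>
  obtain N P where P: "N \<noteq> 0" "X 1 \<epsilon> $ 1 = N * (\<xi> 2 \<epsilon> + \<xi> 1 \<epsilon> * P)" "X 1 \<epsilon> $ 2 = N * ((1 + P) / 2)"
    "P\<^sup>2 * ((\<xi> 3 \<epsilon> - \<xi> 1 \<epsilon>) * (\<xi> 4 \<epsilon> - \<xi> 1 \<epsilon>)) = (\<xi> 3 \<epsilon> - \<xi> 2 \<epsilon>) * (\<xi> 4 \<epsilon> - \<xi> 2 \<epsilon>)"
    using col(3)[of 1, OF insertI1, unfolded idx] by blast
  obtain M Q where Q: "M \<noteq> 0" "X 2 \<epsilon> $ 1 = M * (\<xi> 3 \<epsilon> + \<xi> 2 \<epsilon> * Q)" "X 2 \<epsilon> $ 2 = M * ((1 + Q) / 2)"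
    "Q\<^sup>2 * ((\<xi> 4 \<epsilon> - \<xi> 2 \<epsilon>) * (\<xi> 1 \<epsilon> - \<xi> 2 \<epsilon>)) = (\<xi> 4 \<epsilon> - \<xi> 3 \<epsilon>) * (\<xi> 1 \<epsilon> - \<xi> 3 \<epsilon>)"
    using col(3)[of 2, OF insertI2[OF singletonI], unfolded idx] by blast
  \<comment> \<open>Up to a nonzero factor the determinant compares the fixed points of the two
    involutions; the cross-multiplied form also covers a fixed point at infinity.\<close>
  have det: "X 1 \<epsilon> $ 1 * X 2 \<epsilon> $ 2 - X 2 \<epsilon> $ 1 * X 1 \<epsilon> $ 2 = N * M / 2 *
      ((\<xi> 2 \<epsilon> + \<xi> 1 \<epsilon> * P) * (1 + Q) - (\<xi> 3 \<epsilon> + \<xi> 2 \<epsilon> * Q) * (1 + P))"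
    unfolding P(2,3) Q(2,3) by (simp add: field_simps)
  have "(\<xi> 2 \<epsilon> + \<xi> 1 \<epsilon> * P) * (1 + Q) \<noteq> (\<xi> 3 \<epsilon> + \<xi> 2 \<epsilon> * Q) * (1 + P)"
    by (rule involution_fixed_points_distinct[OF _ _ _ _ _ _ P(4) Q(4)]) (rule dist[OF \<epsilon>]; simp)+
  then have "X 1 \<epsilon> $ 1 * X 2 \<epsilon> $ 2 - X 2 \<epsilon> $ 1 * X 1 \<epsilon> $ 2 \<noteq> 0"
    unfolding det using P(1) Q(1) by simp
  then show "invertible (transpose (vector [chi_col \<xi> 1 (\<sigma> 1) (\<rho> 1) (f 1) (g 1) \<epsilon>,
      chi_col \<xi> 2 (\<sigma> 2) (\<rho> 2) (f 2) (g 2) \<epsilon>] :: complex^2^2))"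
    unfolding X_def' by (simp add: invertible_det_nz det_2 transpose_def vector_2)
qed

end
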